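(* Let $n$ be an even positive integer, let $L\subset\mathbb{R}^n$ be a lattice, let $G\subset O(n)$ be a finite group with $gL=L$ for all $g\in G$, and let $J\in \mathrm{GL}(n,\mathbb{R})$ satisfy $J^2=-1$ and $Jg=gJ$ for all $g\in G$. The set of biholomorphism classes of flat Kähler manifolds of the form $\mathbb{R}^n/\Gamma$ with the complex structure induced by $J$, where $\Gamma\subset\mathrm{Isom}(\mathbb{R}^n)$ is a Bieberbach group with translation lattice $L$ and holonomy group $G$ (so that $\Gamma$ fits into the short exact sequence $0\to L\to\Gamma\to G\to 1$), is in one-to-one correspondence with the set of orbits of the action $*$ of the group $$N^J=\{A\in N(G) : AJ=JA\}$$ on the set of special cohomology classes of $H^2(G,L)$.
   Context: A Bieberbach group of dimension $n$ is a discrete, cocompact, torsion-free subgroup $\Gamma$ of $\mathrm{Isom}(\mathbb{R}^n)=O(n)\ltimes\mathbb{R}^n$. Its translation lattice $L$ is the group of all vectors $l$ with $(1,l)\in\Gamma$, and its holonomy group is $G=\{A : (A,a)\in\Gamma\}$. There is a short exact sequence $0\to L\xrightarrow{i}\Gamma\xrightarrow{r}G\to1$ with $i(l)=(1,l)$, $r(A,a)=A$; $G$ acts on $L$ by matrix multiplication, and the extension is classified by a class in $H^2(G,L)$. A class in $H^2(G,L)$ is called special if the corresponding extension of $G$ by $L$ is torsion-free. A flat Kähler manifold is a flat manifold $\mathbb{R}^n/\Gamma$ with the complex structure induced from the complex vector space $(\mathbb{R}^n,J)$, where $J\in\mathrm{GL}(n,\mathbb{R})$, $J^2=-1$, $J$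 commutes with $G$. $\mathrm{GL}(L)=\{A\in\mathrm{GL}(n,\mathbb{R}) : AL=A^{-1}L=L\}$ and $N(G)=\{A\in\mathrm{GL}(L): AGA^{-1}=G\}$. The group $N(G)$ acts on $H^2(G,L)$ by the action $*$ induced from the action on 2-cocycles $f\colon G\times G\to L$ given by $(A*f)(a,b)=A\,f(A^{-1}aA,\,A^{-1}bA)$ for $A\in N(G)$, $a,b\in G$. *)

theory Defs
  imports "HOL-Analysis.Analysis" "HOL-Algebra.Group_Action"
begin

section \<open>Matrix groups and lattices\<close>

definition matrix_GL :: "(real^'n^'n) monoid" where
  "matrix_GL = \<lparr>carrier = {A. invertible A}, mult = (**), one = mat 1\<rparr>"

definition is_lattice :: "(real^'n) set \<Rightarrow> bool" where
  "is_lattice L \<longleftrightarrow> (\<exists>B. independent B \<and> span B = UNIV \<and>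
     L = {(\<Sum>b\<in>B. of_int (c b) *\<^sub>R b) | c :: real^'n \<Rightarrow> int. True})"

definition GL_lattice :: "(real^'n) set \<Rightarrow> (real^'n^'n) set" where
  "GL_lattice L = {A. invertible A \<and> (*v) A ` L = L \<and> (*v) (matrix_inv A) ` L = L}"

definition lattice_normalizer :: "(real^'n) set \<Rightarrow> (real^'n^'n) set \<Rightarrow> (real^'n^'n) set" where
  "lattice_normalizer L G = {A \<in> GL_lattice L. (\<lambda>g. A ** g ** matrix_inv A) ` G = G}"

definition complex_normalizer ::
    "(real^'n) set \<Rightarrow> (real^'n^'n) set \<Rightarrow> real^'n^'n \<Rightarrow> (real^'n^'n) monoid" where
  "complex_normalizer L G J =
     matrix_GL\<lparr>carrier := {A \<in> lattice_normalizer L G. A ** J = J ** A}\<rparr>"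

section \<open>Bieberbach groups\<close>

text \<open>The pair \<open>(A, a)\<close> stands for the isometry \<open>x \<mapsto> A x + a\<close>.\<close>

definition isom_group :: "((real^'n^'n) \<times> (real^'n)) monoid" where
  "isom_group = \<lparr>carrier = {(A, a). orthogonal_matrix A},
     mult = (\<lambda>(A, a) (B, b). (A ** B, a + A *v b)),
     one = (mat 1, 0)\<rparr>"

definition torsion_free :: "'a monoid \<Rightarrow> bool" where
  "torsion_free E \<longleftrightarrow> (\<forall>x\<in>carrier E. \<forall>k::nat. k > 0 \<longrightarrow> x [^]\<^bsub>E\<^esub> k = \<one>\<^bsub>E\<^esub> \<longrightarrow> x = \<one>\<^bsub>E\<^esub>)"

definition orbit_of :: "((real^'n^'n) \<times> (real^'n)) set \<Rightarrow> real^'n \<Rightarrow> (real^'n) set" where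
  "orbit_of \<Gamma> x = (\<lambda>(A, a). A *v x + a) ` \<Gamma>"

text \<open>The orbit space of \<open>\<Gamma>\<close> with the quotient topology.\<close>

definition orbit_space :: "((real^'n^'n) \<times> (real^'n)) set \<Rightarrow> (real^'n) set topology" where
  "orbit_space \<Gamma> = topology (\<lambda>U. U \<subseteq> range (orbit_of \<Gamma>) \<and> open (orbit_of \<Gamma> -` U))"

lemma openin_orbit_space:
  "openin (orbit_space \<Gamma>) U \<longleftrightarrow> U \<subseteq> range (orbit_of \<Gamma>) \<and> open (orbit_of \<Gamma> -` U)"
proof -
  have "istopology (\<lambda>U. U \<subseteq> range (orbit_of \<Gamma>) \<and> open (orbit_of \<Gamma> -` U))"
    unfolding istopology_def by (auto simp: vimage_Union intro!: open_Int)
  then show ?thesis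
    by (simp add: orbit_space_def topology_inverse')
qed

lemma topspace_orbit_space: "topspace (orbit_space \<Gamma>) = range (orbit_of \<Gamma>)"
proof -
  have "orbit_of \<Gamma> -` range (orbit_of \<Gamma>) = UNIV"
    by auto
  then have "openin (orbit_space \<Gamma>) (range (orbit_of \<Gamma>))"
    by (simp add: openin_orbit_space)
  then show ?thesis
    by (metis openin_orbit_space openin_subset openin_topspace subset_antisym)
qed

lemma quotient_map_orbit_of: "quotient_map euclidean (orbit_space \<Gamma>) (orbit_of \<Gamma>)"
  by (simp add: quotient_map_def topspace_orbit_space openin_orbit_space vimage_def)

definition bieberbach_group :: "((real^'n^'n) \<times> (real^'n)) set \<Rightarrow> bool" where
  "bieberbach_group \<Gamma> \<longleftrightarrow> subgroup \<Gamma> isom_group \<and> discrete \<Gamma> \<and>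
     compact_space (orbit_space \<Gamma>) \<and> torsion_free (isom_group\<lparr>carrier := \<Gamma>\<rparr>)"

definition translation_lattice :: "((real^'n^'n) \<times> (real^'n)) set \<Rightarrow> (real^'n) set" where
  "translation_lattice \<Gamma> = {l. (mat 1, l) \<in> \<Gamma>}"

definition holonomy_group :: "((real^'n^'n) \<times> (real^'n)) set \<Rightarrow> (real^'n^'n) set" where
  "holonomy_group \<Gamma> = fst ` \<Gamma>"

definition bieberbach_groups ::
    "(real^'n) set \<Rightarrow> (real^'n^'n) set \<Rightarrow> ((real^'n^'n) \<times> (real^'n)) set set" where
  "bieberbach_groups L G =
     {\<Gamma>. bieberbach_group \<Gamma> \<and> translation_lattice \<Gamma> = L \<and> holonomy_group \<Gamma> = G}"

section \<open>Complex structures and biholomorphisms\<close>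

text \<open>A function between open subsets of \<open>(\<real>\<^sup>n, J)\<close> is holomorphic iff it is
  differentiable with complex linear (i.e. \<open>J\<close>-commuting) derivative.\<close>

definition J_holomorphic_on ::
    "real^'n^'n \<Rightarrow> (real^'n \<Rightarrow> real^'n) \<Rightarrow> (real^'n) set \<Rightarrow> bool" where
  "J_holomorphic_on J f U \<longleftrightarrow>
     (\<forall>x\<in>U. \<exists>D. (f has_derivative D) (at x) \<and> (\<forall>v. D (J *v v) = J *v D v))"

text \<open>A manifold is a topology with an atlas, a set of charts \<open>(U, \<phi>)\<close> where \<open>\<phi>\<close> maps the
  open set \<open>U\<close> homeomorphically onto an open subset of \<open>\<real>\<^sup>n\<close>. Values of \<open>\<phi>\<close> outside \<open>U\<close>
  are irrelevant. The complex structure \<open>J\<close> on the model space is a separate parameter.\<close>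

type_synonym ('a, 'n) charted_space = "'a topology \<times> ('a set \<times> ('a \<Rightarrow> real^'n)) set"

definition holomorphic_map ::
    "real^'n^'n \<Rightarrow> ('a, 'n) charted_space \<Rightarrow> ('b, 'n) charted_space \<Rightarrow> ('a \<Rightarrow> 'b) \<Rightarrow> bool" where
  "holomorphic_map J M N h \<longleftrightarrow> continuous_map (fst M) (fst N) h \<and>
     (\<forall>(U, \<phi>)\<in>snd M. \<forall>(V, \<psi>)\<in>snd N.
        J_holomorphic_on J (\<psi> \<circ> h \<circ> inv_into U \<phi>) (\<phi> ` {x\<in>U. h x \<in> V}))"

definition biholomorphic ::
    "real^'n^'n \<Rightarrow> ('a, 'n) charted_space \<Rightarrow> ('b, 'n) charted_space \<Rightarrow> bool" where
  "biholomorphic J M N \<longleftrightarrow> (\<exists>h k. holomorphic_map J M N h \<and> holomorphic_map J N M k \<and>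
     (\<forall>x\<in>topspace (fst M). k (h x) = x) \<and> (\<forall>y\<in>topspace (fst N). h (k y) = y))"

text \<open>The charts of \<open>\<real>\<^sup>n/\<Gamma>\<close> are the local inverses of the projection. Their transition maps
  are locally given by elements of \<open>\<Gamma>\<close>, so the atlas is \<open>J\<close>-holomorphic when \<open>J\<close> commutes
  with the holonomy of \<open>\<Gamma>\<close>.\<close>

definition flat_manifold ::
    "((real^'n^'n) \<times> (real^'n)) set \<Rightarrow> ((real^'n) set, 'n) charted_space" where
  "flat_manifold \<Gamma> = (orbit_space \<Gamma>,
     {(orbit_of \<Gamma> ` W, inv_into W (orbit_of \<Gamma>)) | W. open W \<and> inj_on (orbit_of \<Gamma>) W})"

definition flat_kaehler_manifolds ::
    "(real^'n) set \<Rightarrow> (real^'n^'n) set \<Rightarrow> ((real^'n) set, 'n) charted_space set" where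
  "flat_kaehler_manifolds L G = flat_manifold ` bieberbach_groups L G"

definition biholomorphism_rel ::
    "real^'n^'n \<Rightarrow> ('a, 'n) charted_space set \<Rightarrow> (('a, 'n) charted_space) rel" where
  "biholomorphism_rel J \<M> = {(M, N). M \<in> \<M> \<and> N \<in> \<M> \<and> biholomorphic J M N}"

section \<open>Second cohomology\<close>

definition cocycles ::
    "(real^'n^'n) set \<Rightarrow> (real^'n) set \<Rightarrow> ((real^'n^'n) \<times> (real^'n^'n) \<Rightarrow> real^'n) set" where
  "cocycles G L = {f \<in> G \<times> G \<rightarrow>\<^sub>E L. \<forall>a\<in>G. \<forall>b\<in>G. \<forall>c\<in>G.
     a *v f (b, c) - f (a ** b, c) + f (a, b ** c) - f (a, b) = 0}"

definition coboundaries ::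
    "(real^'n^'n) set \<Rightarrow> (real^'n) set \<Rightarrow> ((real^'n^'n) \<times> (real^'n^'n) \<Rightarrow> real^'n) set" where
  "coboundaries G L =
     {\<lambda>(a, b)\<in>G \<times> G. a *v t b - t (a ** b) + t a | t. t \<in> G \<rightarrow> L}"

definition cocycle_group ::
    "(real^'n^'n) set \<Rightarrow> (real^'n) set \<Rightarrow> ((real^'n^'n) \<times> (real^'n^'n) \<Rightarrow> real^'n) monoid" where
  "cocycle_group G L = \<lparr>carrier = cocycles G L,
     mult = (\<lambda>f g. \<lambda>p\<in>G \<times> G. f p + g p),
     one = (\<lambda>p\<in>G \<times> G. 0)\<rparr>"

definition H2 ::
    "(real^'n^'n) set \<Rightarrow> (real^'n) set \<Rightarrow> ((real^'n^'n) \<times> (real^'n^'n) \<Rightarrow> real^'n) set monoid" where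
  "H2 G L = cocycle_group G L Mod coboundaries G L"

text \<open>The extension of \<open>G\<close> by \<open>L\<close> with cocycle \<open>f\<close>; \<open>(a, l)\<close> stands for \<open>i l\<close> times the chosen
  lift of \<open>a\<close>. Cocycles are not assumed to be normalized, whence the unit.\<close>

definition cocycle_extension ::
    "(real^'n^'n) set \<Rightarrow> (real^'n) set \<Rightarrow> ((real^'n^'n) \<times> (real^'n^'n) \<Rightarrow> real^'n)
       \<Rightarrow> ((real^'n^'n) \<times> (real^'n)) monoid" where
  "cocycle_extension G L f = \<lparr>carrier = G \<times> L,
     mult = (\<lambda>(a, l) (b, m). (a ** b, l + a *v m + f (a, b))),
     one = (mat 1, - f (mat 1, mat 1))\<rparr>"

text \<open>Cohomologous cocycles have isomorphic extensions, so the choice of representative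
  is immaterial.\<close>

definition special_classes ::
    "(real^'n^'n) set \<Rightarrow> (real^'n) set \<Rightarrow> ((real^'n^'n) \<times> (real^'n^'n) \<Rightarrow> real^'n) set set" where
  "special_classes G L =
     {c \<in> carrier (H2 G L). \<forall>f\<in>c. torsion_free (cocycle_extension G L f)}"

text \<open>The class of the extension \<open>0 \<rightarrow> L \<rightarrow> \<Gamma> \<rightarrow> G \<rightarrow> 1\<close>: all cocycles that arise from
  set-theoretic sections \<open>s\<close> of the projection to \<open>G\<close>.\<close>

definition extension_class ::
    "(real^'n^'n) set \<Rightarrow> (real^'n) set \<Rightarrow> ((real^'n^'n) \<times> (real^'n)) set
       \<Rightarrow> ((real^'n^'n) \<times> (real^'n^'n) \<Rightarrow> real^'n) set" where
  "extension_class G L \<Gamma> = {f \<in> cocycles G L. \<exists>s. (\<forall>a\<in>G. s a \<in> \<Gamma> \<and> fst (s a) = a) \<and>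
     (\<forall>a\<in>G. \<forall>b\<in>G.
        s a \<otimes>\<^bsub>isom_group\<^esub> s b = (mat 1, f (a, b)) \<otimes>\<^bsub>isom_group\<^esub> s (a ** b))}"

definition cocycle_action ::
    "(real^'n^'n) set \<Rightarrow> real^'n^'n \<Rightarrow> ((real^'n^'n) \<times> (real^'n^'n) \<Rightarrow> real^'n)
       \<Rightarrow> ((real^'n^'n) \<times> (real^'n^'n) \<Rightarrow> real^'n)" where
  "cocycle_action G A f = (\<lambda>(a, b)\<in>G \<times> G.
     A *v f (matrix_inv A ** a ** A, matrix_inv A ** b ** A))"

definition class_action ::
    "(real^'n^'n) set \<Rightarrow> real^'n^'n \<Rightarrow> ((real^'n^'n) \<times> (real^'n^'n) \<Rightarrow> real^'n) set
       \<Rightarrow> ((real^'n^'n) \<times> (real^'n^'n) \<Rightarrow> real^'n) set" where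
  "class_action G A c = cocycle_action G A ` c"

end

theory Submission
  imports Defs "HOL-Complex_Analysis.Cauchy_Integral_Formula"
begin

text \<open>
  A biholomorphism between \<open>\<real>\<^sup>n/\<Gamma>\<^sub>1\<close> and \<open>\<real>\<^sup>n/\<Gamma>\<^sub>2\<close> lifts to a map \<open>f\<close> of \<open>\<real>\<^sup>n\<close> that is holomorphic for \<open>J\<close>
  and carries the action of \<open>\<Gamma>\<^sub>1\<close> into that of \<open>\<Gamma>\<^sub>2\<close> (\<open>orbit_lift\<close>, \<open>lift_equivariant\<close>). Since \<open>\<Gamma>\<^sub>1\<close> is
  cocompact and \<open>\<Gamma>\<^sub>2\<close> acts by isometries, \<open>f\<close> grows at most linearly (\<open>equivariant_linear_growth\<close>), and
  then Liouville's theorem forces it to be affine, \<open>f x = A x + a\<close>, with \<open>A J = J A\<close>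
  (\<open>J_holomorphic_linear_growth_imp_affine\<close>). Hence two of the manifolds are biholomorphic if and
  only if their groups are conjugate by an affine map whose linear part commutes with \<open>J\<close>; here
  holomorphy replaces Bieberbach's theorem that isomorphic groups are affinely conjugate. Such
  an \<open>A\<close> automatically preserves the common translation lattice \<open>L\<close> and normalizes the common
  holonomy group \<open>G\<close>.

  The rest is group cohomology. Choosing an element \<open>(c, \<sigma> c)\<close> of \<open>\<Gamma>\<close> for every \<open>c \<in> G\<close> presents the
  extension class of \<open>\<Gamma>\<close> by the cocycle \<open>(c, d) \<mapsto> \<sigma> c + c \<sigma> d - \<sigma> (c d)\<close>. Conjugation by
  \<open>x \<mapsto> A x + a\<close> replaces \<open>\<sigma>\<close> by the map \<open>c \<mapsto> A \<sigma> (A\<^sup>-\<^sup>1 c A) + (a - c a)\<close>. The first term has the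
  cocycle transformed by \<open>A\<close>, and the second one contributes nothing, because it is the coboundary of a
  constant (\<open>cocycle_action_section\<close>). Conversely, averaging over the finite group \<open>G\<close> shows that
  \<open>H\<^sup>1(G, \<real>\<^sup>n)\<close> and \<open>H\<^sup>2(G, \<real>\<^sup>n)\<close> vanish. The first vanishing recovers the translation \<open>a\<close> when the
  classes correspond under \<open>A\<close> (\<open>class_action_imp_affine_conj\<close>). The second one writes any cocycle with
  values in \<open>L\<close> by means of translation parts \<open>\<sigma> c \<in> \<real>\<^sup>n\<close>, so every special class is realized by a
  Bieberbach group (\<open>bieberbach_group_of_cocycle\<close>).
\<close>

section \<open>Matrices and affine maps\<close>

lemma matrix_inv_cancel:
  fixes A :: "real^'n^'n"
  assumes "invertible A"
  shows "A ** matrix_inv A = mat 1" "matrix_inv A ** A = mat 1"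
    "A *v (matrix_inv A *v x) = x" "matrix_inv A *v (A *v x) = x"
proof -
  show 1: "A ** matrix_inv A = mat 1" "matrix_inv A ** A = mat 1"
    using someI_ex[OF assms[unfolded invertible_def]] by (simp_all add: matrix_inv_def)
  show "A *v (matrix_inv A *v x) = x" "matrix_inv A *v (A *v x) = x"
    by (simp_all add: matrix_vector_mul_assoc 1)
qed

lemma matrix_inv_eqI:
  fixes A B :: "real^'n^'n"
  assumes "A ** B = mat 1"
  shows "invertible A" "matrix_inv A = B"
proof -
  have BA: "B ** A = mat 1"
    using assms matrix_left_right_inverse by blast
  show "invertible A"
    using assms BA by (auto simp: invertible_def)
  then show "matrix_inv A = B"
    by (metis BA matrix_inv_cancel(1) matrix_mul_assoc matrix_mul_lid matrix_mul_rid)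
qed

lemma matrix_inv_one: "matrix_inv (mat 1 :: real^'n^'n) = mat 1"
  by (rule matrix_inv_eqI) simp

lemma invertible_matrix_inv:
  fixes A :: "real^'n^'n"
  assumes "invertible A"
  shows "invertible (matrix_inv A)" "matrix_inv (matrix_inv A) = A"
  using matrix_inv_eqI[OF matrix_inv_cancel(2)[OF assms]] by blast+

lemma matrix_inv_mult:
  fixes A B :: "real^'n^'n"
  assumes "invertible A" "invertible B"
  shows "matrix_inv (A ** B) = matrix_inv B ** matrix_inv A"
  by (rule matrix_inv_eqI)
    (metis assms matrix_inv_cancel(1) matrix_mul_assoc matrix_mul_lid)

definition act :: "(real^'n^'n) \<times> (real^'n) \<Rightarrow> real^'n \<Rightarrow> real^'n" where
  "act \<gamma> x = fst \<gamma> *v x + snd \<gamma>"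

lemma act_Pair [simp]: "act (A, a) x = A *v x + a"
  by (simp add: act_def)

lemma act_diff: "act \<gamma> x - act \<gamma> y = fst \<gamma> *v (x - y)"
  by (simp add: act_def matrix_vector_mult_diff_distrib)

lemma act_eqD:
  assumes "\<And>x. act \<gamma> x = act \<delta> x"
  shows "\<gamma> = \<delta>"
proof -
  have "snd \<gamma> = snd \<delta>"
    using assms[of 0] by (simp add: act_def)
  moreover have "fst \<gamma> = fst \<delta>"
    using assms calculation by (simp add: act_def matrix_eq)
  ultimately show ?thesis
    by (simp add: prod_eq_iff)
qed

lemma act_has_derivative: "(act \<gamma> has_derivative (*v) (fst \<gamma>)) (at x)"
proof -
  have "act \<gamma> = (\<lambda>x. fst \<gamma> *v x + snd \<gamma>)"
    by (simp add: act_def fun_eq_iff)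
  then show ?thesis
    by (auto intro!: derivative_eq_intros bounded_linear_imp_has_derivative)
qed

lemma continuous_on_act: "continuous_on S (act \<gamma>)"
  by (meson act_has_derivative continuous_at_imp_continuous_on has_derivative_continuous)

lemma act_mult: "act (\<gamma> \<otimes>\<^bsub>isom_group\<^esub> \<delta>) x = act \<gamma> (act \<delta> x)"
  by (cases \<gamma>; cases \<delta>)
    (simp add: isom_group_def matrix_vector_mul_assoc matrix_vector_right_distrib)

lemma act_one: "act \<one>\<^bsub>isom_group\<^esub> x = x"
  by (simp add: isom_group_def)

lemma orthogonal_matrix_norm:
  fixes A :: "real^'n^'n"
  assumes "orthogonal_matrix A"
  shows "norm (A *v x) = norm x"
  using assms by (simp add: orthogonal_transformation_norm orthogonal_transformation_matrix)

lemma group_isom_group: "group isom_group"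
proof (rule groupI)
  show "x \<otimes>\<^bsub>isom_group\<^esub> y \<in> carrier isom_group"
    if "x \<in> carrier isom_group" "y \<in> carrier isom_group" for x y :: "(real^'n^'n) \<times> (real^'n)"
    using that by (auto simp: isom_group_def orthogonal_matrix_mul)
  show "\<one>\<^bsub>isom_group\<^esub> \<in> carrier isom_group"
    by (simp add: isom_group_def orthogonal_matrix_id)
  show "x \<otimes>\<^bsub>isom_group\<^esub> y \<otimes>\<^bsub>isom_group\<^esub> z = x \<otimes>\<^bsub>isom_group\<^esub> (y \<otimes>\<^bsub>isom_group\<^esub> z)"
    for x y z :: "(real^'n^'n) \<times> (real^'n)"
    by (rule act_eqD) (simp add: act_mult)
  show "\<one>\<^bsub>isom_group\<^esub> \<otimes>\<^bsub>isom_group\<^esub> x = x" for x :: "(real^'n^'n) \<times> (real^'n)"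
    by (rule act_eqD) (simp add: act_mult act_one)
  show "\<exists>y\<in>carrier isom_group. y \<otimes>\<^bsub>isom_group\<^esub> x = \<one>\<^bsub>isom_group\<^esub>"
    if "x \<in> carrier isom_group" for x :: "(real^'n^'n) \<times> (real^'n)"
  proof -
    obtain A a where x: "x = (A, a)" "orthogonal_matrix A"
      using \<open>x \<in> carrier isom_group\<close> by (auto simp: isom_group_def)
    have "(transpose A, - (transpose A *v a)) \<otimes>\<^bsub>isom_group\<^esub> x = \<one>\<^bsub>isom_group\<^esub>"
      using x by (simp add: isom_group_def orthogonal_matrix_def)
    moreover have "(transpose A, - (transpose A *v a)) \<in> carrier isom_group"
      using x by (simp add: isom_group_def)
    ultimately show ?thesis
      by blast
  qed
qed

text \<open>The conjugate of an isometry \<open>\<gamma>\<close> by the affine map \<open>x \<mapsto> A x + a\<close>. Since \<open>A\<close> need not be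
  orthogonal, this is not conjugation inside \<open>isom_group\<close>.\<close>

definition affine_conj ::
  "real^'n^'n \<Rightarrow> real^'n \<Rightarrow> (real^'n^'n) \<times> (real^'n) \<Rightarrow> (real^'n^'n) \<times> (real^'n)" where
  "affine_conj A a \<gamma> =
     (A ** fst \<gamma> ** matrix_inv A, A *v snd \<gamma> + a - (A ** fst \<gamma> ** matrix_inv A) *v a)"

lemma act_affine_conj:
  assumes "invertible A"
  shows "act (affine_conj A a \<gamma>) (act (A, a) x) = act (A, a) (act \<gamma> x)"
  using assms
  by (simp add: affine_conj_def act_def matrix_vector_right_distrib matrix_inv_cancel
      flip: matrix_vector_mul_assoc)

text \<open>Intertwining on points determines the conjugate, because \<open>x \<mapsto> A x + a\<close> is onto.\<close>

lemma affine_conj_eqI: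
  assumes "invertible A" and "\<And>x. act \<delta> (act (A, a) x) = act (A, a) (act \<gamma> x)"
  shows "affine_conj A a \<gamma> = \<delta>"
proof (rule act_eqD)
  fix x
  have "x = act (A, a) (matrix_inv A *v (x - a))"
    using assms(1) by (simp add: matrix_inv_cancel)
  then show "act (affine_conj A a \<gamma>) x = act \<delta> x"
    using assms act_affine_conj by metis
qed

section \<open>Lattices\<close>

lemma is_lattice_subgroup:
  assumes "is_lattice L"
  shows "0 \<in> L" "\<And>x y. x \<in> L \<Longrightarrow> y \<in> L \<Longrightarrow> x + y \<in> L" "\<And>x y. x \<in> L \<Longrightarrow> y \<in> L \<Longrightarrow> x - y \<in> L"
    "\<And>x. x \<in> L \<Longrightarrow> - x \<in> L"
proof -
  obtain B where L: "L = {(\<Sum>b\<in>B. of_int (c b) *\<^sub>R b) | c :: real^'a \<Rightarrow> int. True}"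
    using assms unfolding is_lattice_def by blast
  show 0: "0 \<in> L"
    unfolding L by (rule CollectI, rule exI[of _ "\<lambda>_. 0"]) simp
  show "x + y \<in> L" if xy: "x \<in> L" "y \<in> L" for x y
  proof -
    obtain c d where "x = (\<Sum>b\<in>B. of_int (c b) *\<^sub>R b)" "y = (\<Sum>b\<in>B. of_int (d b) *\<^sub>R b)"
      using xy unfolding L by blast
    then show ?thesis
      unfolding L by (intro CollectI exI[of _ "\<lambda>b. c b + d b"])
        (simp add: scaleR_left_distrib sum.distrib)
  qed
  show diff: "x - y \<in> L" if xy: "x \<in> L" "y \<in> L" for x y
  proof -
    obtain c d where "x = (\<Sum>b\<in>B. of_int (c b) *\<^sub>R b)" "y = (\<Sum>b\<in>B. of_int (d b) *\<^sub>R b)"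
      using xy unfolding L by blast
    then show ?thesis
      unfolding L by (intro CollectI exI[of _ "\<lambda>b. c b - d b"])
        (simp add: scaleR_left_diff_distrib sum_subtractf)
  qed
  show "- x \<in> L" if "x \<in> L" for x
    using diff[OF 0 that] by simp
qed

text \<open>Coordinates with respect to a basis of the lattice are linear functions, hence bounded on
  a ball, and at lattice points they are integers.\<close>

lemma lattice_locally_finite:
  fixes L :: "(real^'n) set"
  assumes "is_lattice L"
  shows "finite (L \<inter> cball 0 r)"
proof -
  obtain B where B: "independent B" "span B = UNIV"
    and L: "L = {(\<Sum>b\<in>B. of_int (c b) *\<^sub>R b) | c :: real^'n \<Rightarrow> int. True}"
    using assms unfolding is_lattice_def by blast
  have finB: "finite B"
    using B(1) independent_imp_finite by blast
  have "\<exists>K>0. \<forall>x. \<bar>representation B x b\<bar> \<le> norm x * K" for b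
  proof -
    have "linear (\<lambda>x. representation B x b)"
      by (rule linearI)
        (simp_all add: B real_vector.representation_add real_vector.representation_scale)
    then have "bounded_linear (\<lambda>x. representation B x b)"
      by (simp add: linear_conv_bounded_linear)
    from bounded_linear.pos_bounded[OF this] show ?thesis
      by simp
  qed
  then obtain K where K: "\<And>b. K b > 0" "\<And>b x. \<bar>representation B x b\<bar> \<le> norm x * K b"
    by metis
  define T where "T = PiE B (\<lambda>b. {- \<lceil>r * K b\<rceil>..\<lceil>r * K b\<rceil>})"
  have "finite T"
    unfolding T_def by (intro finite_PiE finB) auto
  moreover have "L \<inter> cball 0 r \<subseteq> (\<lambda>c. \<Sum>b\<in>B. of_int (c b) *\<^sub>R b) ` T"
  proof
    fix x assume x: "x \<in> L \<inter> cball 0 r"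
    then obtain c :: "real^'n \<Rightarrow> int" where c: "x = (\<Sum>b\<in>B. of_int (c b) *\<^sub>R b)"
      unfolding L by blast
    have "of_int (c b) = representation B x b" if "b \<in> B" for b
    proof -
      have "representation B x = (\<lambda>b. \<Sum>i\<in>B. representation B (of_int (c i) *\<^sub>R i) b)"
        unfolding c using B by (intro real_vector.representation_sum) auto
      then have "representation B x b = (\<Sum>i\<in>B. representation B (of_int (c i) *\<^sub>R i) b)"
        by metis
      also have "\<dots> = (\<Sum>i\<in>B. of_int (c i) * (if b = i then 1 else 0))"
        by (intro sum.cong)
          (simp_all add: B real_vector.representation_scale real_vector.representation_basis)
      also have "\<dots> = of_int (c b)"
        using that finB by (simp add: if_distrib cong: if_cong)
      finally show ?thesis
        by simp
    qed
    moreover have "norm x * K b \<le> r * K b" for b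
      using x K(1)[of b] by (intro mult_right_mono) auto
    ultimately have "\<bar>of_int (c b)\<bar> \<le> r * K b" if "b \<in> B" for b
      using K(2)[where x=x and b=b] that by (metis order_trans)
    note this[THEN order_trans, OF _ le_of_int_ceiling]
    then have "\<bar>c b\<bar> \<le> \<lceil>r * K b\<rceil>" if "b \<in> B" for b
      using that by (metis of_int_abs of_int_le_iff)
    then have "restrict c B \<in> T"
      unfolding T_def by (force simp: abs_le_iff)
    moreover have "x = (\<Sum>b\<in>B. of_int (restrict c B b) *\<^sub>R b)"
      unfolding c by (intro sum.cong) auto
    ultimately show "x \<in> (\<lambda>c. \<Sum>b\<in>B. of_int (c b) *\<^sub>R b) ` T"
      by blast
  qed
  ultimately show ?thesis
    using finite_surj by blast
qed

text \<open>Rounding the coordinates down moves every point by a lattice vector into the fundamental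
  parallelepiped.\<close>

lemma lattice_cobounded:
  fixes L :: "(real^'n) set"
  assumes "is_lattice L"
  shows "\<exists>R. \<forall>x. \<exists>l\<in>L. norm (x + l) \<le> R"
proof -
  obtain B where B: "independent B" "span B = UNIV"
    and L: "L = {(\<Sum>b\<in>B. of_int (c b) *\<^sub>R b) | c :: real^'n \<Rightarrow> int. True}"
    using assms unfolding is_lattice_def by blast
  have finB: "finite B"
    using B(1) independent_imp_finite by blast
  have "\<exists>l\<in>L. norm (x + l) \<le> (\<Sum>b\<in>B. norm b)" for x
  proof
    let ?l = "\<Sum>b\<in>B. of_int (- \<lfloor>representation B x b\<rfloor>) *\<^sub>R b"
    show "?l \<in> L"
      unfolding L by (intro CollectI exI[of _ "\<lambda>b. - \<lfloor>representation B x b\<rfloor>"]) simp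
    have "x + ?l = (\<Sum>b\<in>B. representation B x b *\<^sub>R b) + ?l"
      using B finB by (simp add: real_vector.sum_representation_eq)
    also have "\<dots> = (\<Sum>b\<in>B. frac (representation B x b) *\<^sub>R b)"
      by (simp add: frac_def scaleR_left_diff_distrib sum_subtractf sum_negf)
    also have "norm \<dots> \<le> (\<Sum>b\<in>B. norm b)"
      by (intro sum_norm_le)
        (simp add: mult_left_le_one_le frac_lt_1 frac_ge_0 less_imp_le)
    finally show "norm (x + ?l) \<le> (\<Sum>b\<in>B. norm b)" .
  qed
  then show ?thesis
    by blast
qed

section \<open>Holomorphic maps of linear growth\<close>

text \<open>Restrict \<open>f\<close> to the complex line spanned by \<open>v\<close> and \<open>J v\<close>, and compose with a complex-valued
  functional that turns \<open>J\<close> into multiplication by \<open>\<i>\<close>. The result is an entire function of one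
  variable with linear growth, so by Liouville's theorem it is a polynomial of degree at most 1.
  Enough such functionals and lines exist to conclude that \<open>f\<close> itself equals its Taylor polynomial
  of degree 1 at the origin, and the linear part is a derivative of \<open>f\<close>, hence commutes with \<open>J\<close>.\<close>

lemma J_holomorphic_linear_growth_imp_affine:
  fixes J :: "real^'n^'n" and f :: "real^'n \<Rightarrow> real^'n"
  assumes JJ: "J ** J = - mat 1" and f: "J_holomorphic_on J f UNIV"
    and growth: "\<And>x. norm (f x) \<le> C * (1 + norm x)"
  shows "\<exists>A a. A ** J = J ** A \<and> f = act (A, a)"
proof -
  have JJv: "J *v (J *v x) = - x" for x
  proof -
    have "x + (- mat 1) *v x = (mat 1 + - mat 1) *v x"
      by (simp only: matrix_vector_mult_add_rdistrib matrix_vector_mul_lid)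
    then show ?thesis
      by (simp add: matrix_vector_mul_assoc JJ add_eq_0_iff)
  qed
  obtain D where D: "\<And>x. (f has_derivative D x) (at x)" and DJ: "\<And>x v. D x (J *v v) = J *v D x v"
    using f unfolding J_holomorphic_on_def by (metis UNIV_I)
  have linD: "linear (D x)" for x
    using D has_derivative_linear by blast
  have inner_eq: "u \<bullet> f v = u \<bullet> f 0 + u \<bullet> D 0 v" for u v
  proof -
    \<comment> \<open>Complex linear from \<open>(\<real>\<^sup>n, J)\<close> to \<open>\<complex>\<close>, with real part the functional \<open>w \<mapsto> u \<bullet> w\<close>.\<close>
    define \<phi> where "\<phi> w = Complex (u \<bullet> w) (- (u \<bullet> (J *v w)))" for w
    define \<iota> where "\<iota> z = Re z *\<^sub>R v + Im z *\<^sub>R (J *v v)" for z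
    have lin\<phi>: "bounded_linear \<phi>"
      unfolding linear_conv_bounded_linear[symmetric]
      by (rule linearI) (simp_all add: \<phi>_def complex_eq_iff inner_add_right
          matrix_vector_right_distrib matrix_vector_mult_scaleR)
    have lin\<iota>: "bounded_linear \<iota>"
      unfolding linear_conv_bounded_linear[symmetric]
      by (rule linearI) (simp_all add: \<iota>_def algebra_simps)
    have \<phi>J: "\<phi> (J *v w) = \<i> * \<phi> w" for w
      by (simp add: \<phi>_def complex_eq_iff JJv)
    have "((\<lambda>z. \<phi> (f (\<iota> z))) has_field_derivative \<phi> (D (\<iota> z) v)) (at z)" for z
    proof -
      have "((\<lambda>z. \<phi> (f (\<iota> z))) has_derivative (\<lambda>\<zeta>. \<phi> (D (\<iota> z) (\<iota> \<zeta>)))) (at z)"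
        by (intro bounded_linear.has_derivative[OF lin\<phi>] has_derivative_compose[OF _ D]
            bounded_linear_imp_has_derivative lin\<iota>)
      \<comment> \<open>The real derivative of the composition is multiplication by a complex number.\<close>
      moreover have "\<phi> (D (\<iota> z) (\<iota> \<zeta>)) = \<phi> (D (\<iota> z) v) * \<zeta>" for \<zeta>
      proof -
        have "D (\<iota> z) (\<iota> \<zeta>) = Re \<zeta> *\<^sub>R D (\<iota> z) v + Im \<zeta> *\<^sub>R (J *v D (\<iota> z) v)"
          by (simp add: \<iota>_def linear_add[OF linD] linear_cmul[OF linD] DJ)
        also have "\<phi> \<dots> = Re \<zeta> *\<^sub>R \<phi> (D (\<iota> z) v) + Im \<zeta> *\<^sub>R (\<i> * \<phi> (D (\<iota> z) v))"
          by (simp add: linear_add[OF bounded_linear.linear[OF lin\<phi>]]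
              linear_cmul[OF bounded_linear.linear[OF lin\<phi>]] \<phi>J)
        also have "\<dots> = \<phi> (D (\<iota> z) v) * \<zeta>"
          by (simp add: complex_eq_iff algebra_simps)
        finally show ?thesis .
      qed
      ultimately show ?thesis
        by (simp add: has_field_derivative_def)
    qed
    note deriv = this
    obtain K1 where K1: "K1 > 0" "\<And>w. norm (\<phi> w) \<le> norm w * K1"
      using bounded_linear.pos_bounded[OF lin\<phi>] by blast
    obtain K2 where K2: "K2 > 0" "\<And>z. norm (\<iota> z) \<le> norm z * K2"
      using bounded_linear.pos_bounded[OF lin\<iota>] by blast
    have C: "C \<ge> 0"
      using order_trans[OF norm_ge_zero growth[of 0]] by simp
    \<comment> \<open>The restriction to \<open>norm z \<ge> 1\<close> absorbs the constant term into the linear one.\<close>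
    have bound: "norm (\<phi> (f (\<iota> z))) \<le> C * (1 + K2) * K1 * norm z ^ 1" if "1 \<le> norm z" for z
    proof -
      have "norm (\<phi> (f (\<iota> z))) \<le> C * (1 + norm (\<iota> z)) * K1"
        by (rule order_trans[OF K1(2)]) (intro mult_right_mono growth less_imp_le K1)
      also have "\<dots> \<le> C * (norm z + norm z * K2) * K1"
        using K2(2)[of z] that C K1(1) by (intro mult_right_mono mult_left_mono) auto
      finally show ?thesis
        by (simp add: algebra_simps)
    qed
    have "(\<lambda>z. \<phi> (f (\<iota> z))) holomorphic_on UNIV"
      using deriv by (auto simp: holomorphic_on_open)
    note Liouville_polynomial[OF this bound, where \<xi> = 1]
    also have "(\<Sum>k\<le>1. (deriv ^^ k) (\<lambda>z. \<phi> (f (\<iota> z))) 0 / fact k * 1 ^ k)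
        = \<phi> (f (\<iota> 0)) + deriv (\<lambda>z. \<phi> (f (\<iota> z))) 0"
    proof -
      have "(\<Sum>k\<le>1. g k) = g 0 + g 1" for g :: "nat \<Rightarrow> complex"
        by (simp add: atMost_Suc)
      then show ?thesis
        by (simp only: fact_0 fact_1 power_one mult_1_right div_by_1 funpow_0 One_nat_def
            funpow.simps comp_id id_apply fact_Suc_0)
    qed
    also have "deriv (\<lambda>z. \<phi> (f (\<iota> z))) 0 = \<phi> (D 0 v)"
      using DERIV_imp_deriv[OF deriv[of 0]] by (simp add: \<iota>_def)
    finally show ?thesis
      by (simp add: \<phi>_def \<iota>_def complex_eq_iff)
  qed
  have "u \<bullet> f v = u \<bullet> (f 0 + D 0 v)" for u v
    unfolding inner_add_right by (rule inner_eq)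
  then have eq: "f v = f 0 + D 0 v" for v
    using vector_eq_ldot by blast
  have D0: "matrix (D 0) *v v = D 0 v" for v
    using linD by (simp add: matrix_works)
  have "matrix (D 0) ** J = J ** matrix (D 0)"
    by (simp add: matrix_eq D0 DJ flip: matrix_vector_mul_assoc)
  moreover have "f = act (matrix (D 0), f 0)"
    by (rule ext) (metis eq D0 act_Pair add.commute)
  ultimately show ?thesis
    by blast
qed

section \<open>The covering of the orbit space\<close>

lemma orbit_of_act: "orbit_of \<Gamma> x = (\<lambda>\<gamma>. act \<gamma> x) ` \<Gamma>"
  unfolding orbit_of_def act_def by (intro image_cong) auto

lemma in_orbit_iff: "y \<in> orbit_of \<Gamma> x \<longleftrightarrow> (\<exists>\<gamma>\<in>\<Gamma>. y = act \<gamma> x)"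
  unfolding orbit_of_act by blast

lemma isom_subgroup_act_mult:
  assumes "subgroup \<Gamma> isom_group" "\<gamma> \<in> \<Gamma>" "\<delta> \<in> \<Gamma>"
  shows "\<exists>\<epsilon>\<in>\<Gamma>. \<forall>x. act \<epsilon> x = act \<gamma> (act \<delta> x)"
  using subgroup.m_closed[OF assms] act_mult by metis

lemma isom_subgroup_act_inverse:
  assumes \<Gamma>: "subgroup \<Gamma> isom_group" and \<gamma>: "\<gamma> \<in> \<Gamma>"
  shows "\<exists>\<delta>\<in>\<Gamma>. \<forall>x. act \<delta> (act \<gamma> x) = x \<and> act \<gamma> (act \<delta> x) = x"
proof
  have \<gamma>': "\<gamma> \<in> carrier isom_group"
    using \<gamma> subgroup.subset[OF \<Gamma>] by blast
  show "inv\<^bsub>isom_group\<^esub> \<gamma> \<in> \<Gamma>"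
    using \<gamma> by (rule subgroup.m_inv_closed[OF \<Gamma>])
  show "\<forall>x. act (inv\<^bsub>isom_group\<^esub> \<gamma>) (act \<gamma> x) = x \<and> act \<gamma> (act (inv\<^bsub>isom_group\<^esub> \<gamma>) x) = x"
    using group.l_inv[OF group_isom_group \<gamma>'] group.r_inv[OF group_isom_group \<gamma>']
    by (metis act_mult act_one)
qed

lemma orbit_of_act_eq:
  assumes \<Gamma>: "subgroup \<Gamma> isom_group" and \<gamma>: "\<gamma> \<in> \<Gamma>"
  shows "orbit_of \<Gamma> (act \<gamma> x) = orbit_of \<Gamma> x"
proof -
  have subset: "orbit_of \<Gamma> (act \<gamma> x) \<subseteq> orbit_of \<Gamma> x" if "\<gamma> \<in> \<Gamma>" for \<gamma> x
    using isom_subgroup_act_mult[OF \<Gamma> _ that] by (metis in_orbit_iff subsetI)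
  obtain \<delta> where "\<delta> \<in> \<Gamma>" "act \<delta> (act \<gamma> x) = x"
    using isom_subgroup_act_inverse[OF assms] by blast
  with subset[OF \<gamma>, of x] subset[of \<delta> "act \<gamma> x"] show ?thesis
    by simp
qed

text \<open>Sending an orbit to its distance function embeds the orbit space into a normed space of
  bounded continuous functions; truncating at 1 gives boundedness and changes nothing locally. In
  this realization the projection to the orbit space is a covering map between subsets of normed
  spaces, to which the lifting theorems apply.\<close>

definition truncated_dist :: "(real^'n) set \<Rightarrow> (real^'n) \<Rightarrow>\<^sub>C real" where
  "truncated_dist S = Bcontfun (\<lambda>x. min 1 (infdist x S))"

lemma apply_truncated_dist: "apply_bcontfun (truncated_dist S) x = min 1 (infdist x S)"
proof -
  have "(\<lambda>x. min 1 (infdist x S)) \<in> bcontfun"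
  proof -
    have "\<bar>min 1 (infdist x S)\<bar> \<le> 1" for x
      using infdist_nonneg[of x S] by (simp add: abs_if min_def)
    then show ?thesis
      unfolding bcontfun_def bounded_iff by (auto intro!: continuous_intros exI[of _ 1])
  qed
  then show ?thesis
    by (simp add: truncated_dist_def Bcontfun_inverse)
qed

lemma truncated_dist_less_iff:
  assumes "S \<noteq> {}" "r \<le> 1"
  shows "apply_bcontfun (truncated_dist S) x < r \<longleftrightarrow> (\<exists>z\<in>S. dist x z < r)"
proof -
  have "bdd_below ((\<lambda>z. dist x z) ` S)"
    by (rule bdd_belowI[of _ 0]) auto
  then have "infdist x S < r \<longleftrightarrow> (\<exists>z\<in>S. dist x z < r)"
    using assms(1) by (simp add: infdist_def cINF_less_iff)
  with assms(2) show ?thesis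
    by (auto simp: apply_truncated_dist)
qed

locale bieberbach =
  fixes L :: "(real^'n) set" and G :: "(real^'n^'n) set" and \<Gamma> :: "((real^'n^'n) \<times> (real^'n)) set"
  assumes lattice: "is_lattice L" and finite_G: "finite G"
    and in_bieberbach: "\<Gamma> \<in> bieberbach_groups L G"
begin

lemma subgroup: "subgroup \<Gamma> isom_group"
  and torsion_free: "torsion_free (isom_group\<lparr>carrier := \<Gamma>\<rparr>)"
  and translation_iff: "(mat 1, l) \<in> \<Gamma> \<longleftrightarrow> l \<in> L"
  and holonomy: "fst ` \<Gamma> = G"
  using in_bieberbach
  by (auto simp: bieberbach_groups_def bieberbach_group_def translation_lattice_def
      holonomy_group_def)

lemma orthogonal_fst: "\<gamma> \<in> \<Gamma> \<Longrightarrow> orthogonal_matrix (fst \<gamma>)"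
  using subgroup.subset[OF subgroup] by (auto simp: isom_group_def)

lemma one_closed: "(mat 1, 0) \<in> \<Gamma>"
  using subgroup.one_closed[OF subgroup] by (simp add: isom_group_def)

lemma mult_closed: "(A, a) \<in> \<Gamma> \<Longrightarrow> (B, b) \<in> \<Gamma> \<Longrightarrow> (A ** B, a + A *v b) \<in> \<Gamma>"
  using subgroup.m_closed[OF subgroup, of "(A, a)" "(B, b)"] by (simp add: isom_group_def)

lemmas act_closed = isom_subgroup_act_mult[OF subgroup]
  and act_inverse = isom_subgroup_act_inverse[OF subgroup]

lemma translation_diff:
  assumes "(A, a) \<in> \<Gamma>" "(A, b) \<in> \<Gamma>"
  shows "a - b \<in> L"
proof -
  obtain \<delta> where \<delta>: "\<delta> \<in> \<Gamma>" "\<And>x. act (A, b) (act \<delta> x) = x"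
    using act_inverse[OF assms(2)] by blast
  obtain \<epsilon> where \<epsilon>: "\<epsilon> \<in> \<Gamma>" "\<And>x. act \<epsilon> x = act (A, a) (act \<delta> x)"
    using act_closed[OF assms(1) \<delta>(1)] by blast
  have "act \<epsilon> x = act (mat 1, a - b) x" for x
    using \<epsilon>(2)[of x] \<delta>(2)[of x] by (simp add: algebra_simps)
  then have "\<epsilon> = (mat 1, a - b)"
    by (rule act_eqD)
  with \<epsilon>(1) show ?thesis
    by (simp add: translation_iff)
qed

lemma translation_add:
  assumes "(A, a) \<in> \<Gamma>" "l \<in> L"
  shows "(A, l + a) \<in> \<Gamma>"
  using mult_closed[of "mat 1" l A a] assms by (simp add: translation_iff)

lemma dist_act: "\<gamma> \<in> \<Gamma> \<Longrightarrow> dist (act \<gamma> x) (act \<gamma> y) = dist x y"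
  by (simp add: dist_norm act_diff orthogonal_matrix_norm orthogonal_fst)

text \<open>The group is a union of finitely many cosets of the translation lattice, one for every
  element of \<open>G\<close>, and lattices are locally finite.\<close>

lemma locally_finite: "finite {\<gamma>\<in>\<Gamma>. dist (act \<gamma> x) y \<le> r}"
proof -
  have "finite {\<gamma>\<in>\<Gamma>. fst \<gamma> = A \<and> dist (act \<gamma> x) y \<le> r}" if A: "A \<in> G" for A
  proof -
    obtain a where a: "(A, a) \<in> \<Gamma>"
      using A holonomy by force
    let ?s = "r + norm (A *v x + a - y)"
    have "{\<gamma>\<in>\<Gamma>. fst \<gamma> = A \<and> dist (act \<gamma> x) y \<le> r} \<subseteq> (\<lambda>l. (A, l + a)) ` (L \<inter> cball 0 ?s)"
    proof
      fix \<gamma> assume "\<gamma> \<in> {\<gamma>\<in>\<Gamma>. fst \<gamma> = A \<and> dist (act \<gamma> x) y \<le> r}"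
      then obtain b where b: "\<gamma> = (A, b)" "(A, b) \<in> \<Gamma>" "norm (A *v x + b - y) \<le> r"
        by (cases \<gamma>) (auto simp: dist_norm)
      have "b - a = (A *v x + b - y) - (A *v x + a - y)"
        by simp
      then have "norm (b - a) \<le> ?s"
        using norm_triangle_ineq4[of "A *v x + b - y" "A *v x + a - y"] b(3) by simp
      then show "\<gamma> \<in> (\<lambda>l. (A, l + a)) ` (L \<inter> cball 0 ?s)"
        using translation_diff[OF b(2) a] b(1) by (intro image_eqI[of _ _ "b - a"]) auto
    qed
    then show ?thesis
      using lattice_locally_finite[OF lattice] finite_surj by blast
  qed
  then have "finite (\<Union>A\<in>G. {\<gamma>\<in>\<Gamma>. fst \<gamma> = A \<and> dist (act \<gamma> x) y \<le> r})"
    using finite_G by blast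
  moreover have "{\<gamma>\<in>\<Gamma>. dist (act \<gamma> x) y \<le> r} \<subseteq> \<dots>"
    using holonomy by auto
  ultimately show ?thesis
    by (rule rev_finite_subset)
qed

text \<open>By local finiteness the stabilizer of a point is finite. Its elements therefore have finite
  order, so they are trivial in a torsion-free group.\<close>

lemma free_action:
  assumes "\<gamma> \<in> \<Gamma>" "act \<gamma> x = x"
  shows "\<gamma> = (mat 1, 0)"
proof -
  let ?H = "isom_group\<lparr>carrier := \<Gamma>\<rparr>"
  interpret H: group ?H
    by (rule subgroup.subgroup_is_group[OF subgroup group_isom_group])
  have \<gamma>: "\<gamma> \<in> carrier ?H"
    using assms by simp
  have "act (\<gamma> [^]\<^bsub>?H\<^esub> k) x = x" for k :: nat
    by (induction k) (simp_all add: act_mult act_one assms)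
  moreover have pow: "\<gamma> [^]\<^bsub>?H\<^esub> k \<in> \<Gamma>" for k :: nat
    using H.nat_pow_closed[OF \<gamma>] by simp
  ultimately have "range (\<lambda>k::nat. \<gamma> [^]\<^bsub>?H\<^esub> k) \<subseteq> {\<gamma>\<in>\<Gamma>. dist (act \<gamma> x) x \<le> 0}"
    by auto
  then have "finite (range (\<lambda>k::nat. \<gamma> [^]\<^bsub>?H\<^esub> k))"
    using locally_finite finite_subset by blast
  \<comment> \<open>Two equal powers give a positive power that is trivial.\<close>
  then have "\<not> inj (\<lambda>k::nat. \<gamma> [^]\<^bsub>?H\<^esub> k)"
    using finite_imageD by blast
  then obtain i j :: nat where ij: "\<gamma> [^]\<^bsub>?H\<^esub> i = \<gamma> [^]\<^bsub>?H\<^esub> j" "i < j"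
    unfolding inj_def by (metis linorder_neqE_nat)
  have "\<gamma> [^]\<^bsub>?H\<^esub> i \<otimes>\<^bsub>?H\<^esub> \<gamma> [^]\<^bsub>?H\<^esub> (j - i) = \<gamma> [^]\<^bsub>?H\<^esub> i \<otimes>\<^bsub>?H\<^esub> \<one>\<^bsub>?H\<^esub>"
    using ij H.nat_pow_mult[OF \<gamma>, of i "j - i"] H.r_one[OF H.nat_pow_closed[OF \<gamma>]] by simp
  then have "\<gamma> [^]\<^bsub>?H\<^esub> (j - i) = \<one>\<^bsub>?H\<^esub>"
    using H.l_cancel_one H.nat_pow_closed[OF \<gamma>] H.r_one by metis
  then have "\<gamma> = \<one>\<^bsub>?H\<^esub>"
    using torsion_free \<gamma> \<open>i < j\<close> unfolding torsion_free_def by (metis zero_less_diff)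
  then show ?thesis
    by (simp add: isom_group_def)
qed

text \<open>Only finitely many elements move \<open>x\<close> by at most 1, and the nontrivial ones among them do
  move it; \<open>2 r\<close> is the smaller of 1 and the least such displacement. The bound \<open>r \<le> 1\<close> keeps the balls
  of radius \<open>r\<close> within the range where the truncated distance is the distance.\<close>

lemma separated:
  obtains r where "0 < r" "r \<le> 1"
    "\<And>\<gamma>. \<gamma> \<in> \<Gamma> \<Longrightarrow> \<gamma> \<noteq> (mat 1, 0) \<Longrightarrow> 2 * r \<le> dist (act \<gamma> x) x"
proof -
  let ?S = "{\<gamma>\<in>\<Gamma>. dist (act \<gamma> x) x \<le> 1} - {(mat 1, 0)}"
  let ?D = "insert 1 ((\<lambda>\<gamma>. dist (act \<gamma> x) x) ` ?S)"
  have fin: "finite ?D"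
    using locally_finite by simp
  show ?thesis
  proof
    show "0 < Min ?D / 2"
      using fin free_action by (auto simp: Min_gr_iff)
    show "Min ?D / 2 \<le> 1"
      using Min_le[OF fin, of 1] by simp
    show "2 * (Min ?D / 2) \<le> dist (act \<gamma> x) x" if "\<gamma> \<in> \<Gamma>" "\<gamma> \<noteq> (mat 1, 0)" for \<gamma>
    proof (cases "dist (act \<gamma> x) x \<le> 1")
      case True
      then show ?thesis
        using that Min_le[OF fin, of "dist (act \<gamma> x) x"] by simp
    next
      case False
      then show ?thesis
        using Min_le[OF fin, of 1] by simp
    qed
  qed
qed

lemma self_in_orbit: "x \<in> orbit_of \<Gamma> x"
  unfolding orbit_of_act using one_closed by (rule rev_image_eqI) simp

lemma orbit_eq_iff: "orbit_of \<Gamma> x = orbit_of \<Gamma> y \<longleftrightarrow> x \<in> orbit_of \<Gamma> y"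
  using orbit_of_act_eq[OF subgroup] self_in_orbit by (metis in_orbit_iff)

lemma orbit_eq_iff_act: "orbit_of \<Gamma> x = orbit_of \<Gamma> y \<longleftrightarrow> (\<exists>\<gamma>\<in>\<Gamma>. x = act \<gamma> y)"
  by (simp add: orbit_eq_iff in_orbit_iff)

text \<open>The displacement bound at \<open>x\<close> holds between any two points of its orbit, because the group
  acts by isometries. A displacement of \<open>2 r\<close> makes the balls of radius \<open>r\<close> disjoint.\<close>

lemma separated_ball:
  assumes sep: "\<And>\<gamma>. \<gamma> \<in> \<Gamma> \<Longrightarrow> \<gamma> \<noteq> (mat 1, 0) \<Longrightarrow> 2 * r \<le> dist (act \<gamma> x) x"
    and "y \<in> orbit_of \<Gamma> x" "z \<in> orbit_of \<Gamma> x" "y \<noteq> z"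
  shows "ball y r \<inter> ball z r = {}"
proof -
  obtain \<gamma> \<delta> where \<gamma>\<delta>: "\<gamma> \<in> \<Gamma>" "\<delta> \<in> \<Gamma>" "y = act \<gamma> x" "z = act \<delta> x"
    using assms(2,3) by (auto simp: orbit_of_act)
  obtain \<delta>' where \<delta>': "\<delta>' \<in> \<Gamma>" "\<And>x. act \<delta>' (act \<delta> x) = x"
    using act_inverse[OF \<gamma>\<delta>(2)] by blast
  obtain \<epsilon> where \<epsilon>: "\<epsilon> \<in> \<Gamma>" "\<And>x. act \<epsilon> x = act \<delta>' (act \<gamma> x)"
    using act_closed[OF \<delta>'(1) \<gamma>\<delta>(1)] by blast
  have dist: "dist (act \<epsilon> x) x = dist y z"
    using dist_act[OF \<delta>'(1)] \<epsilon>(2) \<delta>'(2) \<gamma>\<delta> by metis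
  then have "\<epsilon> \<noteq> (mat 1, 0)"
    using \<open>y \<noteq> z\<close> by auto
  then have "2 * r \<le> dist y z"
    using sep[OF \<epsilon>(1)] dist by simp
  show ?thesis
  proof (rule equals0I)
    fix w assume "w \<in> ball y r \<inter> ball z r"
    then show False
      using dist_triangle[of y z w] \<open>2 * r \<le> dist y z\<close> by (simp add: dist_commute)
  qed
qed

text \<open>If \<open>v = \<gamma> w\<close> for two points of the ball, then \<open>v\<close> lies in the balls around \<open>z\<close> and \<open>\<gamma> z\<close>,
  whence \<open>\<gamma> z = z\<close>, and the action is free.\<close>

lemma orbit_separated_ball:
  assumes sep: "\<And>\<gamma>. \<gamma> \<in> \<Gamma> \<Longrightarrow> \<gamma> \<noteq> (mat 1, 0) \<Longrightarrow> 2 * r \<le> dist (act \<gamma> x) x"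
    and z: "z \<in> orbit_of \<Gamma> x"
  shows "inj_on (orbit_of \<Gamma>) (ball z r)"
proof (rule inj_onI)
  fix v w assume vw: "v \<in> ball z r" "w \<in> ball z r" "orbit_of \<Gamma> v = orbit_of \<Gamma> w"
  then obtain \<gamma> where \<gamma>: "\<gamma> \<in> \<Gamma>" "v = act \<gamma> w"
    by (auto simp: orbit_eq_iff_act)
  have "v \<in> ball (act \<gamma> z) r"
    using vw(2) dist_act[OF \<gamma>(1)] \<gamma>(2) by simp
  moreover have "act \<gamma> z \<in> orbit_of \<Gamma> x"
    using z orbit_eq_iff orbit_eq_iff_act \<gamma>(1) by metis
  ultimately have "act \<gamma> z = z"
    using separated_ball[OF sep _ z] vw(1) by blast
  then have "\<gamma> = (mat 1, 0)"
    by (rule free_action[OF \<gamma>(1)])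
  with \<gamma>(2) show "v = w"
    by simp
qed

lemma orbit_locally_injective:
  obtains r where "0 < r" "inj_on (orbit_of \<Gamma>) (ball x r)"
  using separated[of x] orbit_separated_ball[OF _ self_in_orbit, of _ x] by metis

text \<open>Closedness makes distinct orbits have positive distance, so that the distance function
  determines the orbit.\<close>

lemma closed_orbit: "closed (orbit_of \<Gamma> x)"
proof -
  have "finite (orbit_of \<Gamma> x \<inter> ball y 1)" for y
  proof (rule finite_subset)
    show "orbit_of \<Gamma> x \<inter> ball y 1 \<subseteq> (\<lambda>\<gamma>. act \<gamma> x) ` {\<gamma>\<in>\<Gamma>. dist (act \<gamma> x) y \<le> 1}"
      by (auto simp: orbit_of_act dist_commute)
  qed (simp add: locally_finite)
  then show ?thesis
    unfolding closed_limpt islimpt_eq_infinite_ball by (metis zero_less_one)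
qed

text \<open>The projection to the orbit space, in the realization by distance functions.\<close>

definition orbit_dist :: "real^'n \<Rightarrow> (real^'n) \<Rightarrow>\<^sub>C real" where
  "orbit_dist x = truncated_dist (orbit_of \<Gamma> x)"

lemma orbit_dist_less_iff:
  "r \<le> 1 \<Longrightarrow> apply_bcontfun (orbit_dist x) y < r \<longleftrightarrow> (\<exists>z\<in>orbit_of \<Gamma> x. dist y z < r)"
  unfolding orbit_dist_def using self_in_orbit by (intro truncated_dist_less_iff) auto

lemma orbit_dist_eq_iff: "orbit_dist x = orbit_dist y \<longleftrightarrow> orbit_of \<Gamma> x = orbit_of \<Gamma> y"
proof
  assume eq: "orbit_dist x = orbit_dist y"
  have "apply_bcontfun (orbit_dist x) x = 0"
    unfolding orbit_dist_def apply_truncated_dist using self_in_orbit[of x] by simp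
  then have "infdist x (orbit_of \<Gamma> y) = 0"
    unfolding eq by (auto simp: orbit_dist_def apply_truncated_dist min_def split: if_splits)
  then have "x \<in> orbit_of \<Gamma> y"
    using in_closed_iff_infdist_zero[OF closed_orbit] self_in_orbit by blast
  then show "orbit_of \<Gamma> x = orbit_of \<Gamma> y"
    by (simp add: orbit_eq_iff)
qed (simp add: orbit_dist_def)

lemma dist_orbit_dist_le: "dist (orbit_dist x) (orbit_dist y) \<le> dist x y"
proof (rule dist_bound)
  have le: "infdist p (orbit_of \<Gamma> x) \<le> infdist p (orbit_of \<Gamma> y) + dist x y" for p x y
  proof -
    have "infdist p (orbit_of \<Gamma> x) - dist x y \<le> dist p z" if z: "z \<in> orbit_of \<Gamma> y" for z
    proof -
      obtain \<gamma> where \<gamma>: "\<gamma> \<in> \<Gamma>" "z = act \<gamma> y"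
        using z unfolding in_orbit_iff by blast
      then have "act \<gamma> x \<in> orbit_of \<Gamma> x"
        unfolding in_orbit_iff by blast
      then have "infdist p (orbit_of \<Gamma> x) \<le> dist p (act \<gamma> x)"
        by (rule infdist_le)
      also have "\<dots> \<le> dist p z + dist x y"
        using dist_triangle[of p "act \<gamma> x" z] dist_act[OF \<gamma>(1), of x y] \<gamma>(2)
        by (simp add: dist_commute)
      finally show ?thesis
        by simp
    qed
    moreover have "orbit_of \<Gamma> y \<noteq> {}"
      using self_in_orbit[of y] by (metis empty_iff)
    ultimately have "infdist p (orbit_of \<Gamma> x) - dist x y \<le> (INF z\<in>orbit_of \<Gamma> y. dist p z)"
      by (metis (no_types, lifting) cINF_greatest)
    also have "\<dots> = infdist p (orbit_of \<Gamma> y)"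
      using \<open>orbit_of \<Gamma> y \<noteq> {}\<close> by (simp only: infdist_def if_False)
    finally show ?thesis
      by linarith
  qed
  show "dist (apply_bcontfun (orbit_dist x) p) (apply_bcontfun (orbit_dist y) p) \<le> dist x y" for p
  proof -
    have "\<bar>min 1 a - min 1 b\<bar> \<le> d" if "a \<le> b + d" "b \<le> a + d" for a b d :: real
      using that by (auto simp: min_def abs_if)
    from this[OF le[of p x y] le[of p y x, unfolded dist_commute[of y x]]] show ?thesis
      by (simp only: orbit_dist_def apply_truncated_dist dist_real_def)
  qed
qed

lemma continuous_on_orbit_dist: "continuous_on S orbit_dist"
  unfolding continuous_on_iff using dist_orbit_dist_le by (meson order_le_less_trans)

text \<open>The image of a ball is cut out by a condition on the value at one point. Evaluation is
  continuous, so this is what makes \<open>orbit_dist\<close> an open map.\<close>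

lemma orbit_dist_image_ball:
  assumes "z \<in> orbit_of \<Gamma> x" "r \<le> 1"
  shows "orbit_dist ` ball z r = {s \<in> range orbit_dist. apply_bcontfun s x < r}"
proof (intro equalityI subsetI)
  fix s assume "s \<in> orbit_dist ` ball z r"
  then obtain y where y: "s = orbit_dist y" "dist z y < r"
    by auto
  obtain \<gamma> where \<gamma>: "\<gamma> \<in> \<Gamma>" "x = act \<gamma> z"
    using assms(1) orbit_eq_iff orbit_eq_iff_act by metis
  have "dist x (act \<gamma> y) < r"
    using y(2) \<gamma> dist_act by metis
  then have "\<exists>w\<in>orbit_of \<Gamma> y. dist x w < r"
    using \<gamma>(1) by (auto simp: orbit_of_act)
  then show "s \<in> {s \<in> range orbit_dist. apply_bcontfun s x < r}"
    using y(1) by (simp add: orbit_dist_less_iff assms(2))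
next
  fix s assume "s \<in> {s \<in> range orbit_dist. apply_bcontfun s x < r}"
  then obtain y w where y: "s = orbit_dist y" "w \<in> orbit_of \<Gamma> y" "dist x w < r"
    by (auto simp: orbit_dist_less_iff assms(2))
  obtain \<gamma> where \<gamma>: "\<gamma> \<in> \<Gamma>" "z = act \<gamma> x"
    using assms(1) orbit_eq_iff orbit_eq_iff_act by metis
  have "act \<gamma> w \<in> ball z r"
    using y(3) \<gamma> dist_act by (metis mem_ball)
  moreover have "orbit_dist (act \<gamma> w) = s"
    using y(1,2) \<gamma>(1) orbit_dist_eq_iff orbit_eq_iff orbit_eq_iff_act by metis
  ultimately show "s \<in> orbit_dist ` ball z r"
    by blast
qed

lemma orbit_dist_open_map:
  assumes "open W"
  shows "openin (top_of_set (range orbit_dist)) (orbit_dist ` W)"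
proof -
  have "\<exists>T. openin (top_of_set (range orbit_dist)) T \<and> orbit_dist w \<in> T \<and> T \<subseteq> orbit_dist ` W"
    if w: "w \<in> W" for w
  proof -
    obtain e where e: "e > 0" "ball w e \<subseteq> W"
      using assms w openE by blast
    let ?r = "min e 1"
    have "open {s::(real^'n) \<Rightarrow>\<^sub>C real. apply_bcontfun s w < ?r}"
    proof -
      have "continuous_on UNIV (\<lambda>s::(real^'n) \<Rightarrow>\<^sub>C real. apply_bcontfun s w)"
        unfolding continuous_on_iff by (meson dist_fun_lt_imp_dist_val_lt)
      then show ?thesis
        by (intro open_Collect_less) auto
    qed
    moreover have "orbit_dist ` ball w ?r = range orbit_dist \<inter> {s. apply_bcontfun s w < ?r}"
      using orbit_dist_image_ball[OF self_in_orbit, of ?r w] by auto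
    ultimately have "openin (top_of_set (range orbit_dist)) (orbit_dist ` ball w ?r)"
      by (auto simp: openin_open)
    moreover have "orbit_dist w \<in> orbit_dist ` ball w ?r" "orbit_dist ` ball w ?r \<subseteq> orbit_dist ` W"
      using e by auto
    ultimately show ?thesis
      by blast
  qed
  then show ?thesis
    by (subst openin_subopen) blast
qed

text \<open>The image of a small ball around \<open>x\<close> is evenly covered: the sheets are the balls of the same
  radius around the points of the orbit of \<open>x\<close>.\<close>

lemma covering_space_orbit_dist: "covering_space UNIV orbit_dist (range orbit_dist)"
proof
  show "continuous_on UNIV orbit_dist"
    by (rule continuous_on_orbit_dist)
  fix s assume "s \<in> range orbit_dist"
  then obtain x where x: "s = orbit_dist x"
    by blast
  obtain r where r: "0 < r" "r \<le> 1"
    and sep: "\<And>\<gamma>. \<gamma> \<in> \<Gamma> \<Longrightarrow> \<gamma> \<noteq> (mat 1, 0) \<Longrightarrow> 2 * r \<le> dist (act \<gamma> x) x"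
    using separated[of x] by metis
  let ?T = "orbit_dist ` ball x r" and ?v = "(\<lambda>z. ball z r) ` orbit_of \<Gamma> x"
  have T: "orbit_dist ` ball z r = ?T" if "z \<in> orbit_of \<Gamma> x" for z
    using orbit_dist_image_ball[OF that r(2)] orbit_dist_image_ball[OF self_in_orbit r(2), of x]
    by simp
  have "\<Union>?v = UNIV \<inter> orbit_dist -` ?T"
  proof (intro equalityI subsetI)
    fix y assume "y \<in> UNIV \<inter> orbit_dist -` ?T"
    then have "apply_bcontfun (orbit_dist y) x < r"
      using orbit_dist_image_ball[OF self_in_orbit r(2), of x] by simp
    then obtain \<gamma> where \<gamma>: "\<gamma> \<in> \<Gamma>" "dist x (act \<gamma> y) < r"
      by (auto simp: orbit_dist_less_iff r(2) orbit_of_act)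
    then obtain \<delta> where \<delta>: "\<delta> \<in> \<Gamma>" "act \<delta> (act \<gamma> y) = y"
      using act_inverse by metis
    have "y \<in> ball (act \<delta> x) r"
      using \<gamma>(2) dist_act[OF \<delta>(1)] \<delta>(2) by (metis mem_ball)
    then show "y \<in> \<Union>?v"
      using \<delta>(1) by (auto simp: orbit_of_act)
  qed (use T in blast)
  moreover have "pairwise disjnt ?v"
    using separated_ball[OF sep] by (auto simp: pairwise_def disjnt_def)
  moreover have "\<exists>q. homeomorphism u ?T orbit_dist q" if u: "u \<in> ?v" for u
  proof -
    obtain z where z: "z \<in> orbit_of \<Gamma> x" "u = ball z r"
      using u by blast
    show ?thesis
    proof (rule homeomorphism_injective_open_map)
      show "continuous_on u orbit_dist"
        by (rule continuous_on_orbit_dist)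
      show "orbit_dist ` u = ?T"
        using T z by simp
      show "inj_on orbit_dist u"
        using orbit_separated_ball[OF sep z(1)] z(2) by (simp add: inj_on_def orbit_dist_eq_iff)
      show "openin (top_of_set ?T) (orbit_dist ` W)" if "openin (top_of_set u) W" for W
      proof (rule openin_subset_trans)
        show "openin (top_of_set (range orbit_dist)) (orbit_dist ` W)"
          using that z(2) by (intro orbit_dist_open_map) (simp add: openin_open_eq)
        show "orbit_dist ` W \<subseteq> ?T"
          using openin_imp_subset[OF that] T z by blast
      qed blast
    qed blast
  qed
  ultimately show "\<exists>T. s \<in> T \<and> openin (top_of_set (range orbit_dist)) T \<and>
      (\<exists>v. \<Union>v = UNIV \<inter> orbit_dist -` T \<and> (\<forall>u\<in>v. openin (top_of_set UNIV) u) \<and>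
        pairwise disjnt v \<and> (\<forall>u\<in>v. \<exists>q. homeomorphism u T orbit_dist q))"
  proof (intro exI[of _ ?T] conjI exI[of _ ?v])
    show "s \<in> ?T"
      using r(1) x by simp
    show "openin (top_of_set (range orbit_dist)) ?T"
      by (rule orbit_dist_open_map[OF open_ball])
    show "\<forall>u\<in>?v. openin (top_of_set UNIV) u"
      by simp
  qed blast+
qed blast

text \<open>Lifting through a covering with simply connected source. Continuity of \<open>F\<close> refers to the
  quotient topology, and passes to the realization by distance functions because these depend
  continuously on the point that represents an orbit.\<close>

lemma orbit_lift:
  fixes F :: "real^'n \<Rightarrow> (real^'n) set"
  assumes F: "continuous_map euclidean (orbit_space \<Gamma>) F" and "F x0 = orbit_of \<Gamma> y0"
  obtains f where "continuous_on UNIV f" "f x0 = y0" "\<And>x. orbit_of \<Gamma> (f x) = F x"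
proof -
  have F_range: "F x \<in> range (orbit_of \<Gamma>)" for x
    using continuous_map_image_subset_topspace[OF F] by (auto simp: topspace_orbit_space)
  have "continuous_map (orbit_space \<Gamma>) euclidean (truncated_dist :: _ \<Rightarrow> (real^'n) \<Rightarrow>\<^sub>C real)"
  proof (rule continuous_compose_quotient_map[OF quotient_map_orbit_of])
    show "continuous_map euclidean euclidean (truncated_dist \<circ> orbit_of \<Gamma>)"
      using continuous_on_orbit_dist[of UNIV] by (simp add: orbit_dist_def[abs_def] comp_def)
  qed
  from continuous_map_compose[OF F this]
  have cont: "continuous_on UNIV (\<lambda>x. truncated_dist (F x))"
    by (simp add: comp_def)
  obtain f where f: "continuous_on UNIV f" "f x0 = y0"
    "\<And>x. x \<in> UNIV \<Longrightarrow> orbit_dist (f x) = truncated_dist (F x)"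
  proof (rule covering_space_lift_strong[OF covering_space_orbit_dist, of y0 x0 UNIV "\<lambda>x. truncated_dist (F x)"])
    show "simply_connected (UNIV :: (real^'n) set)"
      by (simp add: convex_imp_simply_connected)
    show "locally path_connected (UNIV :: (real^'n) set)"
      by (rule locally_path_connected_UNIV)
    show "truncated_dist (F x0) = orbit_dist y0"
      by (simp add: assms(2) orbit_dist_def)
    show "(\<lambda>x. truncated_dist (F x)) \<in> UNIV \<rightarrow> range orbit_dist"
      using F_range by (auto simp: orbit_dist_def[abs_def] image_iff) metis
  qed (use cont in auto)
  have "orbit_of \<Gamma> (f x) = F x" for x
    using F_range[of x] f(3)[of x] orbit_dist_eq_iff by (auto simp flip: orbit_dist_def)
  with f that show ?thesis
    by blast
qed

lemma orbit_lift_unique: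
  fixes f g :: "real^'n \<Rightarrow> real^'n"
  assumes "continuous_on UNIV f" "continuous_on UNIV g"
    and "\<And>x. orbit_of \<Gamma> (f x) = orbit_of \<Gamma> (g x)" and "f a = g a"
  shows "f x = g x"
proof (rule covering_space_lift_unique[OF covering_space_orbit_dist, of f a g UNIV "orbit_dist \<circ> f"])
  show "continuous_on UNIV (orbit_dist \<circ> f)"
    using assms(1) continuous_on_orbit_dist by (rule continuous_on_compose)
  show "(orbit_dist \<circ> f) x = orbit_dist (g x)" for x
    using assms(3) orbit_dist_eq_iff by simp
qed (use assms in auto)

lemma cobounded: "\<exists>R. \<forall>x. \<exists>\<gamma>\<in>\<Gamma>. norm (act \<gamma> x) \<le> R"
proof -
  obtain R where R: "\<And>x. \<exists>l\<in>L. norm (x + l) \<le> R"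
    using lattice_cobounded[OF lattice] by blast
  have "\<exists>\<gamma>\<in>\<Gamma>. norm (act \<gamma> x) \<le> R" for x
    using R[of x] translation_iff by (metis act_Pair matrix_vector_mul_lid)
  then show ?thesis
    by blast
qed

end

section \<open>Biholomorphisms and affine conjugation\<close>

text \<open>Both sides of the equation lift the same map into the second orbit space. For a suitable \<open>\<delta>\<close>
  they agree at the origin, hence everywhere.\<close>

lemma lift_equivariant:
  assumes "bieberbach L G \<Gamma>\<^sub>1" "bieberbach L G \<Gamma>\<^sub>2"
    and f: "continuous_on UNIV f" "\<And>x. orbit_of \<Gamma>\<^sub>2 (f x) = h (orbit_of \<Gamma>\<^sub>1 x)" and \<gamma>: "\<gamma> \<in> \<Gamma>\<^sub>1"
  shows "\<exists>\<delta>\<in>\<Gamma>\<^sub>2. \<forall>x. f (act \<gamma> x) = act \<delta> (f x)"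
proof -
  interpret M1: bieberbach L G \<Gamma>\<^sub>1 by fact
  interpret M2: bieberbach L G \<Gamma>\<^sub>2 by fact
  have \<gamma>_orbit: "orbit_of \<Gamma>\<^sub>2 (f (act \<gamma> x)) = orbit_of \<Gamma>\<^sub>2 (f x)" for x
    using f(2) \<gamma> M1.orbit_eq_iff_act by metis
  then obtain \<delta> where \<delta>: "\<delta> \<in> \<Gamma>\<^sub>2" "f (act \<gamma> 0) = act \<delta> (f 0)"
    using M2.orbit_eq_iff_act by blast
  have "f (act \<gamma> x) = act \<delta> (f x)" for x
  proof (rule M2.orbit_lift_unique[where f = "\<lambda>x. f (act \<gamma> x)" and g = "\<lambda>x. act \<delta> (f x)" and a = 0])
    show "continuous_on UNIV (\<lambda>x. f (act \<gamma> x))"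
      by (rule continuous_on_compose2[OF f(1) continuous_on_act subset_UNIV])
    show "continuous_on UNIV (\<lambda>x. act \<delta> (f x))"
      by (rule continuous_on_compose2[OF continuous_on_act f(1) subset_UNIV])
    show "orbit_of \<Gamma>\<^sub>2 (f (act \<gamma> x)) = orbit_of \<Gamma>\<^sub>2 (act \<delta> (f x))" for x
      using \<gamma>_orbit \<delta>(1) M2.orbit_eq_iff_act by metis
  qed (rule \<delta>(2))
  with \<delta>(1) show ?thesis
    by blast
qed

text \<open>A pair of points at distance at most 1 can be moved by \<open>\<Gamma>\<^sub>1\<close> into a fixed ball, on which \<open>f\<close> is
  bounded. As \<open>\<Gamma>\<^sub>2\<close> consists of isometries, this bounds how far apart \<open>f\<close> maps the original pair.
  The origin is joined to \<open>x\<close> by about \<open>norm x\<close> such steps.\<close>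

lemma equivariant_linear_growth:
  assumes "bieberbach L G \<Gamma>\<^sub>1" "bieberbach L G \<Gamma>\<^sub>2"
    and f: "continuous_on UNIV f"
    and equiv: "\<And>\<gamma>. \<gamma> \<in> \<Gamma>\<^sub>1 \<Longrightarrow> \<exists>\<delta>\<in>\<Gamma>\<^sub>2. \<forall>x. f (act \<gamma> x) = act \<delta> (f x)"
  shows "\<exists>C. \<forall>x. norm (f x) \<le> C * (1 + norm x)"
proof -
  interpret M1: bieberbach L G \<Gamma>\<^sub>1 by fact
  interpret M2: bieberbach L G \<Gamma>\<^sub>2 by fact
  obtain R where R: "\<And>x. \<exists>\<gamma>\<in>\<Gamma>\<^sub>1. norm (act \<gamma> x) \<le> R"
    using M1.cobounded by blast
  have "compact (f ` cball 0 (R + 1))"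
    using f continuous_on_subset by (intro compact_continuous_image) auto
  then obtain K where "\<forall>y\<in>f ` cball 0 (R + 1). norm y \<le> K"
    using compact_imp_bounded bounded_iff by blast
  then have K: "norm (f x) \<le> K" if "norm x \<le> R + 1" for x
    using that by simp
  have step: "dist (f x) (f y) \<le> 2 * K" if "dist x y \<le> 1" for x y
  proof -
    obtain \<gamma> where \<gamma>: "\<gamma> \<in> \<Gamma>\<^sub>1" "norm (act \<gamma> x) \<le> R"
      using R by blast
    obtain \<delta> where \<delta>: "\<delta> \<in> \<Gamma>\<^sub>2" "\<And>x. f (act \<gamma> x) = act \<delta> (f x)"
      using equiv[OF \<gamma>(1)] by blast
    have "norm (act \<gamma> y) \<le> R + 1"
      using M1.dist_act[OF \<gamma>(1), of x y] that \<gamma>(2) norm_triangle_ineq2[of "act \<gamma> y" "act \<gamma> x"]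
      by (simp add: dist_norm norm_minus_commute)
    moreover have "dist (f x) (f y) = norm (f (act \<gamma> x) - f (act \<gamma> y))"
      using M2.dist_act[OF \<delta>(1), of "f x" "f y"] \<delta>(2) by (simp add: dist_norm)
    ultimately show ?thesis
      using K[of "act \<gamma> x"] K[of "act \<gamma> y"] \<gamma>(2)
        norm_triangle_ineq4[of "f (act \<gamma> x)" "f (act \<gamma> y)"] by simp
  qed
  have growth: "norm (f x) \<le> norm (f 0) + real m * (2 * K)" if "norm x \<le> real m" for m x
    using that
  proof (induction m arbitrary: x)
    case (Suc m)
    \<comment> \<open>The point one step of length at most 1 closer to the origin.\<close>
    let ?y = "(real m / real (Suc m)) *\<^sub>R x"
    have "norm ?y = real m * (norm x / real (Suc m))"
      by simp
    also have "\<dots> \<le> real m * 1"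
      using Suc.prems by (intro mult_left_mono) (auto simp: divide_le_eq_1)
    finally have "norm (f ?y) \<le> norm (f 0) + real m * (2 * K)"
      by (intro Suc.IH) simp
    moreover have "x - ?y = (1 / real (Suc m)) *\<^sub>R x"
    proof -
      have "x - ?y = (1 - real m / real (Suc m)) *\<^sub>R x"
        by (simp add: scaleR_left_diff_distrib)
      also have "1 - real m / real (Suc m) = 1 / real (Suc m)"
        by (simp add: field_simps)
      finally show ?thesis .
    qed
    then have "dist x ?y = norm x / real (Suc m)"
      by (simp add: dist_norm)
    then have "dist x ?y \<le> 1"
      using Suc.prems by (simp add: divide_le_eq_1)
    from step[OF this] have "norm (f x) \<le> norm (f ?y) + 2 * K"
      using norm_triangle_ineq2[of "f x" "f ?y"] by (simp add: dist_norm)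
    ultimately show ?case
      by (simp add: algebra_simps)
  qed simp
  have "K \<ge> 0"
    using step[of 0 0] by simp
  have "norm (f x) \<le> (norm (f 0) + 2 * K) * (1 + norm x)" for x
  proof -
    have "norm (f x) \<le> norm (f 0) + real (nat \<lceil>norm x\<rceil>) * (2 * K)"
      by (intro growth) (simp add: real_nat_ceiling_ge)
    also have "\<dots> \<le> norm (f 0) * (1 + norm x) + (1 + norm x) * (2 * K)"
      using \<open>K \<ge> 0\<close> by (intro add_mono mult_right_mono) (auto simp: algebra_simps, linarith)
    finally show ?thesis
      by (simp add: algebra_simps)
  qed
  then show ?thesis
    by blast
qed

text \<open>The inverse of a chart is the projection to the orbit space.\<close>

lemma inv_into_chart:
  assumes "inj_on p W" "w \<in> W"
  shows "inv_into (p ` W) (inv_into W p) w = p w"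
  by (rule inv_into_f_eq) (use assms in \<open>auto simp: inj_on_inv_into\<close>)

text \<open>Near a point \<open>x\<close>, the lift is the expression of \<open>h\<close> in charts around the images of \<open>x\<close> and \<open>f x\<close>.\<close>

lemma lift_holomorphic:
  assumes "bieberbach L G \<Gamma>\<^sub>1" "bieberbach L G \<Gamma>\<^sub>2"
    and f: "continuous_on UNIV f" "\<And>x. orbit_of \<Gamma>\<^sub>2 (f x) = h (orbit_of \<Gamma>\<^sub>1 x)"
    and h: "holomorphic_map J (flat_manifold \<Gamma>\<^sub>1) (flat_manifold \<Gamma>\<^sub>2) h"
  shows "J_holomorphic_on J f UNIV"
  unfolding J_holomorphic_on_def
proof
  fix x
  interpret M1: bieberbach L G \<Gamma>\<^sub>1 by fact
  interpret M2: bieberbach L G \<Gamma>\<^sub>2 by fact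
  obtain r where r: "0 < r" "inj_on (orbit_of \<Gamma>\<^sub>1) (ball x r)"
    using M1.orbit_locally_injective by blast
  obtain s where s: "0 < s" "inj_on (orbit_of \<Gamma>\<^sub>2) (ball (f x) s)"
    using M2.orbit_locally_injective by blast
  let ?W = "ball x r" and ?V = "ball (f x) s"
  let ?\<phi> = "inv_into ?W (orbit_of \<Gamma>\<^sub>1)" and ?\<psi> = "inv_into ?V (orbit_of \<Gamma>\<^sub>2)"
  let ?g = "?\<psi> \<circ> h \<circ> inv_into (orbit_of \<Gamma>\<^sub>1 ` ?W) ?\<phi>"
  have "(orbit_of \<Gamma>\<^sub>1 ` ?W, ?\<phi>) \<in> snd (flat_manifold \<Gamma>\<^sub>1)"
    "(orbit_of \<Gamma>\<^sub>2 ` ?V, ?\<psi>) \<in> snd (flat_manifold \<Gamma>\<^sub>2)"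
    using r s by (auto simp: flat_manifold_def)
  with h have g: "J_holomorphic_on J ?g
      (?\<phi> ` {u \<in> orbit_of \<Gamma>\<^sub>1 ` ?W. h u \<in> orbit_of \<Gamma>\<^sub>2 ` ?V})"
    unfolding holomorphic_map_def by blast
  have "x = ?\<phi> (orbit_of \<Gamma>\<^sub>1 x)"
    using r by simp
  moreover have "h (orbit_of \<Gamma>\<^sub>1 x) \<in> orbit_of \<Gamma>\<^sub>2 ` ?V"
    using s by (simp flip: f(2))
  ultimately have "x \<in> ?\<phi> ` {u \<in> orbit_of \<Gamma>\<^sub>1 ` ?W. h u \<in> orbit_of \<Gamma>\<^sub>2 ` ?V}"
    using r(1) by (intro image_eqI[where x = "orbit_of \<Gamma>\<^sub>1 x"]) simp_all
  then obtain D where D: "(?g has_derivative D) (at x)" "\<And>v. D (J *v v) = J *v D v"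
    using g unfolding J_holomorphic_on_def by blast
  have "(f has_derivative D) (at x)"
  proof (rule has_derivative_transform_within_open[OF D(1)])
    show "open (?W \<inter> f -` ?V)"
      using f(1) by (intro open_Int open_vimage) auto
    show "x \<in> ?W \<inter> f -` ?V"
      using r s by simp
    show "?g w = f w" if "w \<in> ?W \<inter> f -` ?V" for w
      using that by (simp add: inv_into_chart r s flip: f(2))
  qed
  with D(2) show "\<exists>D. (f has_derivative D) (at x) \<and> (\<forall>v. D (J *v v) = J *v D v)"
    by blast
qed

text \<open>The lift is holomorphic of linear growth, so Liouville's theorem applies.\<close>

lemma holomorphic_lift_affine:
  assumes "bieberbach L G \<Gamma>\<^sub>1" "bieberbach L G \<Gamma>\<^sub>2" and "J ** J = - mat 1"
    and h: "holomorphic_map J (flat_manifold \<Gamma>\<^sub>1) (flat_manifold \<Gamma>\<^sub>2) h"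
    and base: "h (orbit_of \<Gamma>\<^sub>1 x0) = orbit_of \<Gamma>\<^sub>2 y0"
  obtains A a where "A ** J = J ** A" "act (A, a) x0 = y0"
    "\<And>x. orbit_of \<Gamma>\<^sub>2 (act (A, a) x) = h (orbit_of \<Gamma>\<^sub>1 x)"
proof -
  interpret M2: bieberbach L G \<Gamma>\<^sub>2 by fact
  have "continuous_map (orbit_space \<Gamma>\<^sub>1) (orbit_space \<Gamma>\<^sub>2) h"
    using h by (simp add: holomorphic_map_def flat_manifold_def)
  then have "continuous_map euclidean (orbit_space \<Gamma>\<^sub>2) (h \<circ> orbit_of \<Gamma>\<^sub>1)"
    using continuous_map_compose quotient_imp_continuous_map[OF quotient_map_orbit_of] by blast
  then obtain f where f: "continuous_on UNIV f" "f x0 = y0"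
    "\<And>x. orbit_of \<Gamma>\<^sub>2 (f x) = h (orbit_of \<Gamma>\<^sub>1 x)"
    using M2.orbit_lift[of "h \<circ> orbit_of \<Gamma>\<^sub>1" x0 y0] base by (auto simp: comp_def)
  obtain C where "\<And>x. norm (f x) \<le> C * (1 + norm x)"
    using equivariant_linear_growth[OF assms(1,2) f(1)]
      lift_equivariant[OF assms(1,2) f(1), of h] f(3) by blast
  then obtain A a where "A ** J = J ** A" "f = act (A, a)"
    using J_holomorphic_linear_growth_imp_affine[OF assms(3) lift_holomorphic[OF assms(1,2) f(1,3) h]]
    by blast
  with f that show ?thesis
    by blast
qed

text \<open>Lifts of a biholomorphism and of its inverse that match at one point are inverse to each
  other, since lifts are unique. Equivariance of the first lift gives one inclusion between the
  conjugate of \<open>\<Gamma>\<^sub>1\<close> and \<open>\<Gamma>\<^sub>2\<close>, equivariance of the second lift the other.\<close>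

lemma biholomorphic_imp_affine_conj:
  assumes "bieberbach L G \<Gamma>\<^sub>1" "bieberbach L G \<Gamma>\<^sub>2" and "J ** J = - mat 1"
    and "biholomorphic J (flat_manifold \<Gamma>\<^sub>1) (flat_manifold \<Gamma>\<^sub>2)"
  obtains A a where "invertible A" "A ** J = J ** A" "affine_conj A a ` \<Gamma>\<^sub>1 = \<Gamma>\<^sub>2"
proof -
  interpret M1: bieberbach L G \<Gamma>\<^sub>1 by fact
  interpret M2: bieberbach L G \<Gamma>\<^sub>2 by fact
  obtain h k where h: "holomorphic_map J (flat_manifold \<Gamma>\<^sub>1) (flat_manifold \<Gamma>\<^sub>2) h"
    and k: "holomorphic_map J (flat_manifold \<Gamma>\<^sub>2) (flat_manifold \<Gamma>\<^sub>1) k"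
    and kh: "\<And>x. k (h (orbit_of \<Gamma>\<^sub>1 x)) = orbit_of \<Gamma>\<^sub>1 x"
    and hk: "\<And>x. h (k (orbit_of \<Gamma>\<^sub>2 x)) = orbit_of \<Gamma>\<^sub>2 x"
    using assms(4) by (auto simp: biholomorphic_def flat_manifold_def topspace_orbit_space)
  have "h (orbit_of \<Gamma>\<^sub>1 0) \<in> range (orbit_of \<Gamma>\<^sub>2)"
    using h continuous_map_image_subset_topspace[of "orbit_space \<Gamma>\<^sub>1" "orbit_space \<Gamma>\<^sub>2" h]
    by (auto simp: holomorphic_map_def flat_manifold_def topspace_orbit_space)
  then obtain y0 where y0: "h (orbit_of \<Gamma>\<^sub>1 0) = orbit_of \<Gamma>\<^sub>2 y0"
    by blast
  obtain A a where A: "A ** J = J ** A" "act (A, a) 0 = y0"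
    and Aa: "\<And>x. orbit_of \<Gamma>\<^sub>2 (act (A, a) x) = h (orbit_of \<Gamma>\<^sub>1 x)"
    using holomorphic_lift_affine[OF assms(1-3) h y0] by metis
  have "k (orbit_of \<Gamma>\<^sub>2 y0) = orbit_of \<Gamma>\<^sub>1 0"
    using kh y0 by metis
  then obtain B b where B: "act (B, b) y0 = 0"
    and Bb: "\<And>x. orbit_of \<Gamma>\<^sub>1 (act (B, b) x) = k (orbit_of \<Gamma>\<^sub>2 x)"
    using holomorphic_lift_affine[OF assms(2,1,3) k] by metis
  have cont: "continuous_on UNIV (\<lambda>x. act \<alpha> (act \<beta> x))" for \<alpha> \<beta> :: "(real^'a^'a) \<times> (real^'a)"
    by (rule continuous_on_compose2[OF continuous_on_act continuous_on_act subset_UNIV])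
  have BA: "act (B, b) (act (A, a) x) = x" for x
    by (rule M1.orbit_lift_unique[where a = 0, OF cont continuous_on_id])
      (simp_all only: Aa Bb kh A B)
  have AB: "act (A, a) (act (B, b) x) = x" for x
    by (rule M2.orbit_lift_unique[where a = y0, OF cont continuous_on_id])
      (simp_all only: Aa Bb hk A B)
  have "act (A ** B, A *v b + a) x = act (mat 1, 0) x" for x
    using AB[of x] by (simp add: matrix_vector_right_distrib matrix_vector_mul_assoc add.assoc)
  then have "A ** B = mat 1"
    using act_eqD by blast
  then have inv: "invertible A"
    by (rule matrix_inv_eqI)
  have "affine_conj A a ` \<Gamma>\<^sub>1 = \<Gamma>\<^sub>2"
  proof (intro equalityI subsetI)
    fix \<delta> assume "\<delta> \<in> affine_conj A a ` \<Gamma>\<^sub>1"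
    then obtain \<gamma> where \<gamma>: "\<gamma> \<in> \<Gamma>\<^sub>1" "\<delta> = affine_conj A a \<gamma>"
      by blast
    obtain \<delta>' where "\<delta>' \<in> \<Gamma>\<^sub>2" "\<And>x. act (A, a) (act \<gamma> x) = act \<delta>' (act (A, a) x)"
      using lift_equivariant[OF assms(1,2) continuous_on_act Aa \<gamma>(1)] by blast
    then show "\<delta> \<in> \<Gamma>\<^sub>2"
      using affine_conj_eqI[OF inv, of \<delta>' a \<gamma>] \<gamma>(2) by metis
  next
    fix \<delta> assume \<delta>: "\<delta> \<in> \<Gamma>\<^sub>2"
    obtain \<gamma> where \<gamma>: "\<gamma> \<in> \<Gamma>\<^sub>1" "\<And>x. act (B, b) (act \<delta> x) = act \<gamma> (act (B, b) x)"
      using lift_equivariant[OF assms(2,1) continuous_on_act Bb \<delta>] by blast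
    have "affine_conj A a \<gamma> = \<delta>"
      by (rule affine_conj_eqI[OF inv]) (metis AB BA \<gamma>(2))
    with \<gamma>(1) show "\<delta> \<in> affine_conj A a ` \<Gamma>\<^sub>1"
      by blast
  qed
  with inv A(1) that show ?thesis
    by blast
qed

lemma affine_conj_inverse:
  assumes "invertible A"
  shows "affine_conj (matrix_inv A) (- (matrix_inv A *v a)) (affine_conj A a \<gamma>) = \<gamma>"
proof (rule affine_conj_eqI[OF invertible_matrix_inv(1)[OF assms]])
  fix x
  let ?\<beta> = "(matrix_inv A, - (matrix_inv A *v a))"
  have inv: "act (A, a) (act ?\<beta> x) = x" "act ?\<beta> (act (A, a) x) = x" for x
    using assms by (simp_all add: matrix_vector_right_distrib matrix_inv_cancel
        matrix_vector_mult_diff_distrib)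
  then show "act \<gamma> (act ?\<beta> x) = act ?\<beta> (act (affine_conj A a \<gamma>) x)"
    using act_affine_conj[OF assms] by metis
qed

lemma orbit_of_affine_conj:
  assumes "invertible A"
  shows "act (A, a) ` orbit_of \<Gamma> x = orbit_of (affine_conj A a ` \<Gamma>) (act (A, a) x)"
  by (simp only: orbit_of_act image_image act_affine_conj[OF assms])

text \<open>In any two charts, the induced map is locally \<open>\<delta>\<close> composed with \<open>x \<mapsto> A x + a\<close> for some
  \<open>\<delta> \<in> \<Gamma>\<^sub>2\<close> that brings the point into the domain of the second chart. The linear part of \<open>\<delta>\<close>
  belongs to the holonomy group and so commutes with \<open>J\<close>, as \<open>A\<close> does.\<close>

lemma affine_conj_holomorphic_map:
  assumes "bieberbach L G \<Gamma>\<^sub>2" and A: "invertible A" "A ** J = J ** A"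
    and conj: "affine_conj A a ` \<Gamma>\<^sub>1 = \<Gamma>\<^sub>2" and GJ: "\<forall>g\<in>G. J ** g = g ** J"
  shows "holomorphic_map J (flat_manifold \<Gamma>\<^sub>1) (flat_manifold \<Gamma>\<^sub>2) ((`) (act (A, a)))"
proof -
  interpret M2: bieberbach L G \<Gamma>\<^sub>2 by fact
  let ?h = "(`) (act (A, a))"
  have h: "?h (orbit_of \<Gamma>\<^sub>1 x) = orbit_of \<Gamma>\<^sub>2 (act (A, a) x)" for x
    using orbit_of_affine_conj[OF A(1)] conj by simp
  have "continuous_map euclidean (orbit_space \<Gamma>\<^sub>2) (orbit_of \<Gamma>\<^sub>2 \<circ> act (A, a))"
    using continuous_on_act quotient_imp_continuous_map[OF quotient_map_orbit_of]
    by (intro continuous_map_compose[of _ euclidean]) auto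
  moreover have "?h \<circ> orbit_of \<Gamma>\<^sub>1 = orbit_of \<Gamma>\<^sub>2 \<circ> act (A, a)"
    using h by (simp add: fun_eq_iff)
  ultimately have "continuous_map (orbit_space \<Gamma>\<^sub>1) (orbit_space \<Gamma>\<^sub>2) ?h"
    using continuous_compose_quotient_map[OF quotient_map_orbit_of] by metis
  moreover have "J_holomorphic_on J
      (inv_into V (orbit_of \<Gamma>\<^sub>2) \<circ> ?h \<circ> inv_into (orbit_of \<Gamma>\<^sub>1 ` W) (inv_into W (orbit_of \<Gamma>\<^sub>1)))
      (inv_into W (orbit_of \<Gamma>\<^sub>1) ` {u \<in> orbit_of \<Gamma>\<^sub>1 ` W. ?h u \<in> orbit_of \<Gamma>\<^sub>2 ` V})"
      (is "J_holomorphic_on J ?g ?S")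
    if W: "open W" "inj_on (orbit_of \<Gamma>\<^sub>1) W" and V: "open V" "inj_on (orbit_of \<Gamma>\<^sub>2) V" for W V
    unfolding J_holomorphic_on_def
  proof
    fix x assume "x \<in> ?S"
    then obtain y where y: "y \<in> W" "?h (orbit_of \<Gamma>\<^sub>1 y) \<in> orbit_of \<Gamma>\<^sub>2 ` V"
        "x = inv_into W (orbit_of \<Gamma>\<^sub>1) (orbit_of \<Gamma>\<^sub>1 y)"
      by blast
    then have x: "x \<in> W" "orbit_of \<Gamma>\<^sub>2 (act (A, a) x) \<in> orbit_of \<Gamma>\<^sub>2 ` V"
      using W(2) h by simp_all
    then obtain \<delta> where \<delta>: "\<delta> \<in> \<Gamma>\<^sub>2" "act \<delta> (act (A, a) x) \<in> V"
      using M2.orbit_eq_iff_act by (metis imageE)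
    let ?f = "\<lambda>x. act \<delta> (act (A, a) x)"
    have D: "(?f has_derivative (\<lambda>v. fst \<delta> *v (A *v v))) (at x)"
      using has_derivative_compose[OF act_has_derivative[of "(A, a)" x] act_has_derivative[of \<delta>]] by simp
    have "(?g has_derivative (\<lambda>v. fst \<delta> *v (A *v v))) (at x)"
    proof (rule has_derivative_transform_within_open[OF D])
      show "open (W \<inter> ?f -` V)"
        using W(1) V(1)
        by (intro open_Int open_vimage continuous_on_compose2[OF continuous_on_act continuous_on_act]) auto
      show "x \<in> W \<inter> ?f -` V"
        using x(1) \<delta>(2) by simp
      show "?f w = ?g w" if w: "w \<in> W \<inter> ?f -` V" for w
      proof -
        have "?g w = inv_into V (orbit_of \<Gamma>\<^sub>2) (orbit_of \<Gamma>\<^sub>2 (act (A, a) w))"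
          using w W by (simp add: inv_into_chart h del: act_Pair)
        also have "orbit_of \<Gamma>\<^sub>2 (act (A, a) w) = orbit_of \<Gamma>\<^sub>2 (?f w)"
          using \<delta>(1) M2.orbit_eq_iff_act by metis
        also have "inv_into V (orbit_of \<Gamma>\<^sub>2) \<dots> = ?f w"
          using w V by simp
        finally show ?thesis ..
      qed
    qed
    moreover have "J ** fst \<delta> = fst \<delta> ** J"
      using \<delta>(1) M2.holonomy GJ by blast
    then have "fst \<delta> ** (A ** J) = J ** (fst \<delta> ** A)"
      by (simp add: A(2) matrix_mul_assoc)
    then have "fst \<delta> *v (A *v (J *v v)) = J *v (fst \<delta> *v (A *v v))" for v
      by (simp add: matrix_vector_mul_assoc matrix_mul_assoc)
    ultimately show "\<exists>D. (?g has_derivative D) (at x) \<and> (\<forall>v. D (J *v v) = J *v D v)"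
      by blast
  qed
  ultimately show ?thesis
    unfolding holomorphic_map_def flat_manifold_def by auto
qed

lemma affine_conj_imp_biholomorphic:
  assumes "bieberbach L G \<Gamma>\<^sub>1" "bieberbach L G \<Gamma>\<^sub>2"
    and A: "invertible A" "A ** J = J ** A"
    and conj: "affine_conj A a ` \<Gamma>\<^sub>1 = \<Gamma>\<^sub>2" and GJ: "\<forall>g\<in>G. J ** g = g ** J"
  shows "biholomorphic J (flat_manifold \<Gamma>\<^sub>1) (flat_manifold \<Gamma>\<^sub>2)"
proof -
  let ?\<alpha> = "(A, a)" and ?\<beta> = "(matrix_inv A, - (matrix_inv A *v a))"
  have inv: "act ?\<alpha> (act ?\<beta> x) = x" "act ?\<beta> (act ?\<alpha> x) = x" for x
    using A(1) by (simp_all add: matrix_vector_right_distrib matrix_inv_cancel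
        matrix_vector_mult_diff_distrib)
  have "affine_conj (matrix_inv A) (- (matrix_inv A *v a)) ` \<Gamma>\<^sub>2 = \<Gamma>\<^sub>1"
    unfolding conj[symmetric] by (simp add: image_image affine_conj_inverse[OF A(1)])
  moreover have "matrix_inv A ** J = J ** matrix_inv A"
    by (metis A matrix_inv_cancel(1,2) matrix_mul_assoc matrix_mul_lid matrix_mul_rid)
  ultimately have "holomorphic_map J (flat_manifold \<Gamma>\<^sub>2) (flat_manifold \<Gamma>\<^sub>1) ((`) (act ?\<beta>))"
    using affine_conj_holomorphic_map[OF assms(1)] invertible_matrix_inv(1)[OF A(1)] GJ by blast
  moreover have "holomorphic_map J (flat_manifold \<Gamma>\<^sub>1) (flat_manifold \<Gamma>\<^sub>2) ((`) (act ?\<alpha>))"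
    by (rule affine_conj_holomorphic_map[OF assms(2) A conj GJ])
  moreover have "act ?\<beta> ` act ?\<alpha> ` S = S" "act ?\<alpha> ` act ?\<beta> ` S = S" for S
    by (simp_all only: image_image inv image_ident)
  ultimately show ?thesis
    unfolding biholomorphic_def by blast
qed

section \<open>Cocycles and extensions\<close>

lemma group_matrix_GL: "group matrix_GL"
proof (rule groupI)
  show "x \<otimes>\<^bsub>matrix_GL\<^esub> y \<in> carrier matrix_GL"
    if "x \<in> carrier matrix_GL" "y \<in> carrier matrix_GL" for x y :: "real^'n^'n"
    using that by (simp add: matrix_GL_def invertible_mult)
  show "\<one>\<^bsub>matrix_GL\<^esub> \<in> carrier matrix_GL"
    by (simp add: matrix_GL_def matrix_inv_eqI(1)[of "mat 1" "mat 1"])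
  show "\<exists>y\<in>carrier matrix_GL. y \<otimes>\<^bsub>matrix_GL\<^esub> x = \<one>\<^bsub>matrix_GL\<^esub>"
    if "x \<in> carrier matrix_GL" for x :: "real^'n^'n"
    using that matrix_inv_cancel(2)[of x] invertible_matrix_inv(1)[of x]
    by (auto simp: matrix_GL_def)
qed (simp_all add: matrix_GL_def matrix_mul_assoc)

text \<open>The cocycle of the set-theoretic section \<open>a \<mapsto> (a, \<sigma> a)\<close>, that is, the coboundary of \<open>\<sigma>\<close> as a
  cochain with values in \<open>\<real>\<^sup>n\<close>. Even when \<open>\<sigma>\<close> does not take values in \<open>L\<close>, its coboundary may do so.\<close>

definition section_cocycle ::
  "(real^'n^'n) set \<Rightarrow> (real^'n^'n \<Rightarrow> real^'n) \<Rightarrow> (real^'n^'n) \<times> (real^'n^'n) \<Rightarrow> real^'n" where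
  "section_cocycle G \<sigma> = (\<lambda>(a, b)\<in>G \<times> G. \<sigma> a + a *v \<sigma> b - \<sigma> (a ** b))"

lemma section_cocycle_apply:
  "a \<in> G \<Longrightarrow> b \<in> G \<Longrightarrow> section_cocycle G \<sigma> (a, b) = \<sigma> a + a *v \<sigma> b - \<sigma> (a ** b)"
  by (simp add: section_cocycle_def)

lemma cocycles_extensional: "f \<in> cocycles G L \<Longrightarrow> f \<in> extensional (G \<times> G)"
  by (auto simp: cocycles_def PiE_def)

lemma section_cocycle_eqI:
  assumes "f \<in> extensional (G \<times> G)"
    and "\<And>a b. a \<in> G \<Longrightarrow> b \<in> G \<Longrightarrow> f (a, b) = \<sigma> a + a *v \<sigma> b - \<sigma> (a ** b)"
  shows "f = section_cocycle G \<sigma>"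
  using assms(1) unfolding section_cocycle_def
  by (rule extensionalityI[OF _ restrict_extensional]) (use assms(2) in auto)

text \<open>This moves torsion-freeness in both directions between a subgroup of the isometry group and
  its description by a cocycle.\<close>

lemma torsion_free_transfer:
  assumes "torsion_free F"
    and closed: "\<And>x y. x \<in> carrier E \<Longrightarrow> y \<in> carrier E \<Longrightarrow> x \<otimes>\<^bsub>E\<^esub> y \<in> carrier E"
    and one: "\<one>\<^bsub>E\<^esub> \<in> carrier E" "\<psi> \<one>\<^bsub>E\<^esub> = \<one>\<^bsub>F\<^esub>"
    and hom: "\<And>x y. x \<in> carrier E \<Longrightarrow> y \<in> carrier E \<Longrightarrow> \<psi> (x \<otimes>\<^bsub>E\<^esub> y) = \<psi> x \<otimes>\<^bsub>F\<^esub> \<psi> y"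
    and \<psi>: "\<And>x. x \<in> carrier E \<Longrightarrow> \<psi> x \<in> carrier F" "inj_on \<psi> (carrier E)"
  shows "torsion_free E"
  unfolding torsion_free_def
proof (intro ballI allI impI)
  fix x and k :: nat assume x: "x \<in> carrier E" and k: "0 < k" "x [^]\<^bsub>E\<^esub> k = \<one>\<^bsub>E\<^esub>"
  have "x [^]\<^bsub>E\<^esub> m \<in> carrier E \<and> \<psi> (x [^]\<^bsub>E\<^esub> m) = \<psi> x [^]\<^bsub>F\<^esub> m" for m :: nat
    by (induction m) (simp_all add: nat_pow_def x one closed hom)
  then have "\<psi> x [^]\<^bsub>F\<^esub> k = \<one>\<^bsub>F\<^esub>"
    using k(2) one(2) by metis
  then have "\<psi> x = \<psi> \<one>\<^bsub>E\<^esub>"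
    using assms(1) \<psi>(1)[OF x] k(1) one(2) unfolding torsion_free_def by simp
  then show "x = \<one>\<^bsub>E\<^esub>"
    using \<psi>(2) x one(1) by (simp add: inj_on_eq_iff)
qed

locale holonomy_representation =
  fixes L :: "(real^'n) set" and G :: "(real^'n^'n) set"
  assumes lattice: "is_lattice L" and subgroup_G: "subgroup G matrix_GL" and finite_G: "finite G"
    and orthogonal: "\<forall>g\<in>G. orthogonal_matrix g" and image_L: "\<forall>g\<in>G. (*v) g ` L = L"
begin

lemma G_one: "mat 1 \<in> G"
  using subgroup.one_closed[OF subgroup_G] by (simp add: matrix_GL_def)

lemma G_mult: "a \<in> G \<Longrightarrow> b \<in> G \<Longrightarrow> a ** b \<in> G"
  using subgroup.m_closed[OF subgroup_G] by (simp add: matrix_GL_def)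

lemma G_invertible: "a \<in> G \<Longrightarrow> invertible a"
  using subgroup.subset[OF subgroup_G] by (auto simp: matrix_GL_def)

lemma G_inv: "a \<in> G \<Longrightarrow> matrix_inv a \<in> G"
  using subgroup.m_inv_closed[OF subgroup_G, of a] G_invertible[of a]
    group.inv_equality[OF group_matrix_GL, of "matrix_inv a" a]
  by (simp add: matrix_GL_def matrix_inv_cancel invertible_matrix_inv)

lemma L_act: "a \<in> G \<Longrightarrow> l \<in> L \<Longrightarrow> a *v l \<in> L"
  using image_L by blast

lemmas L_zero = is_lattice_subgroup(1)[OF lattice]
  and L_add = is_lattice_subgroup(2)[OF lattice]
  and L_diff = is_lattice_subgroup(3)[OF lattice]
  and L_minus = is_lattice_subgroup(4)[OF lattice]

lemma sum_translate_G:
  fixes f :: "real^'n^'n \<Rightarrow> real^'n"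
  assumes "b \<in> G"
  shows "(\<Sum>c\<in>G. f (b ** c)) = (\<Sum>c\<in>G. f c)"
  by (rule sum.reindex_bij_witness[of _ "\<lambda>c. matrix_inv b ** c" "\<lambda>c. b ** c"])
    (use assms in \<open>simp_all add: G_mult G_inv matrix_mul_assoc matrix_inv_cancel G_invertible\<close>)

lemma card_G_pos: "real (card G) > 0"
  using G_one finite_G by (auto simp: card_gt_0_iff)

text \<open>\<open>H\<^sup>1(G, \<real>\<^sup>n) = 0\<close> for finite \<open>G\<close>: average the cocycle identity over the second argument.\<close>

lemma one_cocycle_is_coboundary:
  assumes "\<And>a b. a \<in> G \<Longrightarrow> b \<in> G \<Longrightarrow> u (a ** b) = u a + a *v u b"
  obtains w where "\<And>a. a \<in> G \<Longrightarrow> u a = w - a *v w"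
proof
  let ?w = "(1 / real (card G)) *\<^sub>R (\<Sum>c\<in>G. u c)"
  fix a assume a: "a \<in> G"
  have "(\<Sum>c\<in>G. u c) = (\<Sum>c\<in>G. u a + a *v u c)"
    using sum_translate_G[OF a, of u] assms[OF a] by simp
  also have "\<dots> = real (card G) *\<^sub>R u a + a *v (\<Sum>c\<in>G. u c)"
    by (simp add: sum.distrib vec.sum scaleR_conv_of_real sum_constant_scaleR)
  finally have "?w = u a + a *v ?w"
    using card_G_pos
    by (metis (no_types, lifting) scaleR_right_distrib matrix_vector_mult_scaleR scaleR_scaleR
        less_irrefl nonzero_divide_eq_eq scaleR_one)
  then show "u a = ?w - a *v ?w"
    by (metis eq_diff_eq)
qed

text \<open>\<open>H\<^sup>2(G, \<real>\<^sup>n) = 0\<close> for finite \<open>G\<close>: average the cocycle identity over the third argument. The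
  cochain \<open>\<sigma>\<close> that results has values in \<open>\<real>\<^sup>n\<close>, and these will be the translation parts of a group
  of isometries.\<close>

lemma two_cocycle_is_section_cocycle:
  assumes f: "f \<in> cocycles G L"
  obtains \<sigma> where "f = section_cocycle G \<sigma>"
proof
  let ?\<sigma> = "\<lambda>a. (1 / real (card G)) *\<^sub>R (\<Sum>c\<in>G. f (a, c))"
  have eq: "f (a, b) = ?\<sigma> a + a *v ?\<sigma> b - ?\<sigma> (a ** b)" if ab: "a \<in> G" "b \<in> G" for a b
  proof -
    have "f (a, b) = a *v f (b, c) - f (a ** b, c) + f (a, b ** c)" if "c \<in> G" for c
      using f ab that unfolding cocycles_def by (simp add: algebra_simps)
    then have "(\<Sum>c\<in>G. f (a, b)) = (\<Sum>c\<in>G. a *v f (b, c) - f (a ** b, c) + f (a, b ** c))"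
      by (rule sum.cong[OF refl])
    also have "\<dots> = a *v (\<Sum>c\<in>G. f (b, c)) - (\<Sum>c\<in>G. f (a ** b, c)) + (\<Sum>c\<in>G. f (a, c))"
      by (simp add: sum.distrib sum_subtractf vec.sum sum_translate_G[OF ab(2), of "\<lambda>c. f (a, c)"])
    finally have "real (card G) *\<^sub>R f (a, b)
        = a *v (\<Sum>c\<in>G. f (b, c)) - (\<Sum>c\<in>G. f (a ** b, c)) + (\<Sum>c\<in>G. f (a, c))"
      by (simp only: sum_constant_scaleR)
    then have "f (a, b) = (1 / real (card G)) *\<^sub>R
        (a *v (\<Sum>c\<in>G. f (b, c)) - (\<Sum>c\<in>G. f (a ** b, c)) + (\<Sum>c\<in>G. f (a, c)))"
      using card_G_pos
      by (metis less_irrefl nonzero_divide_eq_eq scaleR_one scaleR_scaleR)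
    then show ?thesis
      by (simp only: scaleR_right_distrib scaleR_right_diff_distrib matrix_vector_mult_scaleR
          diff_add_eq add_diff_eq add.commute)
  qed
  show "f = section_cocycle G ?\<sigma>"
    by (rule section_cocycle_eqI[OF cocycles_extensional[OF f] eq])
qed

lemma section_cocycle_in_cocycles:
  assumes "\<And>a b. a \<in> G \<Longrightarrow> b \<in> G \<Longrightarrow> \<sigma> a + a *v \<sigma> b - \<sigma> (a ** b) \<in> L"
  shows "section_cocycle G \<sigma> \<in> cocycles G L"
proof -
  have "section_cocycle G \<sigma> \<in> G \<times> G \<rightarrow>\<^sub>E L"
    using assms by (auto simp: section_cocycle_def)
  moreover have "a *v section_cocycle G \<sigma> (b, c) - section_cocycle G \<sigma> (a ** b, c)
      + section_cocycle G \<sigma> (a, b ** c) - section_cocycle G \<sigma> (a, b) = 0"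
    if "a \<in> G" "b \<in> G" "c \<in> G" for a b c
    using that by (simp add: section_cocycle_apply G_mult matrix_vector_right_distrib
        matrix_vector_mult_diff_distrib matrix_vector_mul_assoc matrix_mul_assoc)
  ultimately show ?thesis
    by (simp add: cocycles_def)
qed

definition sections :: "((real^'n^'n) \<times> (real^'n)) set \<Rightarrow> (real^'n^'n \<Rightarrow> real^'n) set" where
  "sections \<Gamma> = {\<sigma>. \<forall>a\<in>G. (a, \<sigma> a) \<in> \<Gamma>}"

lemma bieberbachI: "\<Gamma> \<in> bieberbach_groups L G \<Longrightarrow> bieberbach L G \<Gamma>"
  using lattice finite_G by unfold_locales

lemma sections_nonempty:
  assumes "\<Gamma> \<in> bieberbach_groups L G"
  obtains \<sigma> where "\<sigma> \<in> sections \<Gamma>"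
proof -
  have "\<forall>a\<in>G. \<exists>v. (a, v) \<in> \<Gamma>"
    using assms by (force simp: bieberbach_groups_def holonomy_group_def)
  then show ?thesis
    using that unfolding sections_def by (auto dest!: bchoice)
qed

lemma bieberbach_mem_iff:
  assumes \<Gamma>: "\<Gamma> \<in> bieberbach_groups L G" and \<sigma>: "\<sigma> \<in> sections \<Gamma>"
  shows "(a, v) \<in> \<Gamma> \<longleftrightarrow> a \<in> G \<and> v - \<sigma> a \<in> L"
proof -
  interpret bieberbach L G \<Gamma> by (rule bieberbachI[OF \<Gamma>])
  have "a \<in> G" if "(a, v) \<in> \<Gamma>"
    using that holonomy by force
  then show ?thesis
    using \<sigma> translation_diff[of a v "\<sigma> a"] translation_add[of a "\<sigma> a" "v - \<sigma> a"]
    by (auto simp: sections_def)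
qed

lemma extension_class_eq:
  assumes \<Gamma>: "\<Gamma> \<in> bieberbach_groups L G"
  shows "extension_class G L \<Gamma> = section_cocycle G ` sections \<Gamma>"
proof (intro equalityI subsetI)
  fix f assume "f \<in> extension_class G L \<Gamma>"
  then obtain s where f: "f \<in> cocycles G L"
    and s: "\<And>a. a \<in> G \<Longrightarrow> s a \<in> \<Gamma> \<and> fst (s a) = a"
    and sf: "\<And>a b. a \<in> G \<Longrightarrow> b \<in> G \<Longrightarrow>
      s a \<otimes>\<^bsub>isom_group\<^esub> s b = (mat 1, f (a, b)) \<otimes>\<^bsub>isom_group\<^esub> s (a ** b)"
    unfolding extension_class_def by blast
  have s_eq: "s a = (a, snd (s a))" if "a \<in> G" for a
    using s[OF that] by (metis prod.collapse)
  have "f (a, b) = snd (s a) + a *v snd (s b) - snd (s (a ** b))" if ab: "a \<in> G" "b \<in> G" for a b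
  proof -
    have "snd (s a \<otimes>\<^bsub>isom_group\<^esub> s b) = snd (s a) + a *v snd (s b)"
      by (subst s_eq[OF ab(1)], subst s_eq[OF ab(2)]) (simp add: isom_group_def)
    moreover have "snd ((mat 1, f (a, b)) \<otimes>\<^bsub>isom_group\<^esub> s (a ** b)) = f (a, b) + snd (s (a ** b))"
      by (simp add: isom_group_def split: prod.split)
    ultimately show ?thesis
      using sf[OF ab] by (simp add: algebra_simps)
  qed
  then have "f = section_cocycle G (\<lambda>a. snd (s a))"
    by (rule section_cocycle_eqI[OF cocycles_extensional[OF f]])
  moreover have "(\<lambda>a. snd (s a)) \<in> sections \<Gamma>"
    unfolding sections_def using s s_eq by (intro CollectI ballI) metis
  ultimately show "f \<in> section_cocycle G ` sections \<Gamma>"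
    by blast
next
  interpret bieberbach L G \<Gamma> by (rule bieberbachI[OF \<Gamma>])
  fix f assume "f \<in> section_cocycle G ` sections \<Gamma>"
  then obtain \<sigma> where \<sigma>: "f = section_cocycle G \<sigma>" "\<And>a. a \<in> G \<Longrightarrow> (a, \<sigma> a) \<in> \<Gamma>"
    by (auto simp: sections_def)
  have "\<sigma> a + a *v \<sigma> b - \<sigma> (a ** b) \<in> L" if "a \<in> G" "b \<in> G" for a b
    using translation_diff[OF mult_closed] \<sigma>(2) that G_mult by blast
  then have "f \<in> cocycles G L"
    unfolding \<sigma>(1) by (rule section_cocycle_in_cocycles)
  then show "f \<in> extension_class G L \<Gamma>"
    unfolding extension_class_def using \<sigma>
    by (auto simp: isom_group_def section_cocycle_apply intro!: exI[of _ "\<lambda>a. (a, \<sigma> a)"])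
qed

text \<open>Two sections of the same group differ by a cochain with values in \<open>L\<close>, and any such cochain
  can be added to a section. So the cocycles of sections form a single class.\<close>

lemma extension_class_coset:
  assumes \<Gamma>: "\<Gamma> \<in> bieberbach_groups L G" and \<sigma>: "\<sigma> \<in> sections \<Gamma>"
  shows "extension_class G L \<Gamma> = coboundaries G L #>\<^bsub>cocycle_group G L\<^esub> section_cocycle G \<sigma>"
proof -
  let ?d = "\<lambda>t. \<lambda>(a, b)\<in>G \<times> G. a *v t b - t (a ** b) + t a"
  have eq: "section_cocycle G (\<lambda>a. \<sigma> a + t a) = ?d t \<otimes>\<^bsub>cocycle_group G L\<^esub> section_cocycle G \<sigma>" for t
    by (auto simp: section_cocycle_def cocycle_group_def fun_eq_iff matrix_vector_right_distrib)
  have "section_cocycle G ` sections \<Gamma>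
      = (\<lambda>t. section_cocycle G (\<lambda>a. \<sigma> a + t a)) ` (G \<rightarrow> L)"
  proof (intro equalityI subsetI)
    fix f assume "f \<in> section_cocycle G ` sections \<Gamma>"
    then obtain \<tau> where \<tau>: "\<tau> \<in> sections \<Gamma>" "f = section_cocycle G \<tau>"
      by blast
    have "(\<lambda>a. \<tau> a - \<sigma> a) \<in> G \<rightarrow> L"
      using \<tau>(1) bieberbach_mem_iff[OF assms] by (auto simp: sections_def)
    then show "f \<in> (\<lambda>t. section_cocycle G (\<lambda>a. \<sigma> a + t a)) ` (G \<rightarrow> L)"
      using \<tau>(2) by (intro image_eqI[of _ _ "\<lambda>a. \<tau> a - \<sigma> a"]) auto
  next
    fix f assume "f \<in> (\<lambda>t. section_cocycle G (\<lambda>a. \<sigma> a + t a)) ` (G \<rightarrow> L)"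
    then obtain t where t: "t \<in> G \<rightarrow> L" "f = section_cocycle G (\<lambda>a. \<sigma> a + t a)"
      by blast
    then have "(\<lambda>a. \<sigma> a + t a) \<in> sections \<Gamma>"
      using bieberbach_mem_iff[OF assms] by (auto simp: sections_def)
    with t(2) show "f \<in> section_cocycle G ` sections \<Gamma>"
      by blast
  qed
  also have "\<dots> = (\<lambda>h. h \<otimes>\<^bsub>cocycle_group G L\<^esub> section_cocycle G \<sigma>) ` coboundaries G L"
    unfolding eq coboundaries_def by (auto simp: image_iff)
  also have "\<dots> = coboundaries G L #>\<^bsub>cocycle_group G L\<^esub> section_cocycle G \<sigma>"
    by (auto simp: r_coset_def)
  finally show ?thesis
    using extension_class_eq[OF \<Gamma>] by simp
qed

lemma section_at_one:
  assumes "\<And>a b. a \<in> G \<Longrightarrow> b \<in> G \<Longrightarrow> \<sigma> a + a *v \<sigma> b = f (a, b) + \<sigma> (a ** b)"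
  shows "\<sigma> (mat 1) = f (mat 1, mat 1)"
  using assms[OF G_one G_one] by simp

text \<open>A section \<open>\<tau>\<close> identifies the extension by its cocycle with \<open>\<Gamma>\<close> itself, via \<open>(a, l) \<mapsto> (a, l + \<tau> a)\<close>.\<close>

lemma extension_class_special:
  assumes \<Gamma>: "\<Gamma> \<in> bieberbach_groups L G"
  shows "extension_class G L \<Gamma> \<in> special_classes G L"
proof -
  interpret bieberbach L G \<Gamma> by (rule bieberbachI[OF \<Gamma>])
  obtain \<sigma> where "\<sigma> \<in> sections \<Gamma>"
    using sections_nonempty[OF \<Gamma>] .
  moreover from this have "section_cocycle G \<sigma> \<in> extension_class G L \<Gamma>"
    by (simp add: extension_class_eq[OF \<Gamma>])
  then have "section_cocycle G \<sigma> \<in> carrier (cocycle_group G L)"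
    by (simp add: extension_class_def cocycle_group_def)
  ultimately have "extension_class G L \<Gamma> \<in> carrier (H2 G L)"
    using extension_class_coset[OF \<Gamma>] by (auto simp: H2_def FactGroup_def RCOSETS_def)
  moreover have "torsion_free (cocycle_extension G L f)" if f: "f \<in> extension_class G L \<Gamma>" for f
  proof -
    obtain \<tau> where \<tau>: "\<tau> \<in> sections \<Gamma>" "f = section_cocycle G \<tau>"
      using f extension_class_eq[OF \<Gamma>] by blast
    have fL: "f (a, b) \<in> L" if "a \<in> G" "b \<in> G" for a b
      using f that by (auto simp: extension_class_def cocycles_def PiE_def)
    have f\<tau>: "\<tau> a + a *v \<tau> b = f (a, b) + \<tau> (a ** b)" if "a \<in> G" "b \<in> G" for a b
      using that \<tau>(2) by (simp add: section_cocycle_apply)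
    show ?thesis
    proof (rule torsion_free_transfer[OF torsion_free, where \<psi> = "\<lambda>(a, l). (a, l + \<tau> a)"])
      show "x \<otimes>\<^bsub>cocycle_extension G L f\<^esub> y \<in> carrier (cocycle_extension G L f)"
        if "x \<in> carrier (cocycle_extension G L f)" "y \<in> carrier (cocycle_extension G L f)" for x y
        using that by (auto simp: cocycle_extension_def G_mult L_add L_act fL)
      show "\<one>\<^bsub>cocycle_extension G L f\<^esub> \<in> carrier (cocycle_extension G L f)"
        by (simp add: cocycle_extension_def G_one L_minus fL)
      show "(case \<one>\<^bsub>cocycle_extension G L f\<^esub> of (a, l) \<Rightarrow> (a, l + \<tau> a)) = \<one>\<^bsub>isom_group\<lparr>carrier := \<Gamma>\<rparr>\<^esub>"
        using section_at_one[OF f\<tau>] by (simp add: cocycle_extension_def isom_group_def)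
      show "(case x \<otimes>\<^bsub>cocycle_extension G L f\<^esub> y of (a, l) \<Rightarrow> (a, l + \<tau> a))
          = (case x of (a, l) \<Rightarrow> (a, l + \<tau> a)) \<otimes>\<^bsub>isom_group\<lparr>carrier := \<Gamma>\<rparr>\<^esub> (case y of (a, l) \<Rightarrow> (a, l + \<tau> a))"
        if "x \<in> carrier (cocycle_extension G L f)" "y \<in> carrier (cocycle_extension G L f)" for x y
        using that f\<tau> by (auto simp: cocycle_extension_def isom_group_def matrix_vector_right_distrib algebra_simps)
      show "(case x of (a, l) \<Rightarrow> (a, l + \<tau> a)) \<in> carrier (isom_group\<lparr>carrier := \<Gamma>\<rparr>)"
        if "x \<in> carrier (cocycle_extension G L f)" for x
        using that bieberbach_mem_iff[OF \<Gamma> \<tau>(1)] by (auto simp: cocycle_extension_def)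
      show "inj_on (\<lambda>(a, l). (a, l + \<tau> a)) (carrier (cocycle_extension G L f))"
        by (auto simp: inj_on_def)
    qed
  qed
  ultimately show ?thesis
    by (simp add: special_classes_def)
qed

text \<open>Write the cocycle as the coboundary of a cochain \<open>\<sigma>\<close> with values in \<open>\<real>\<^sup>n\<close>. The isometries
  \<open>(a, l + \<sigma> a)\<close> with \<open>a \<in> G\<close> and \<open>l \<in> L\<close> then multiply as in the extension. Discreteness and
  cocompactness are inherited from \<open>L\<close>.\<close>

lemma bieberbach_group_of_cocycle:
  assumes f: "f \<in> cocycles G L" and tf: "torsion_free (cocycle_extension G L f)"
  obtains \<Gamma> \<sigma> where "\<Gamma> \<in> bieberbach_groups L G" "\<sigma> \<in> sections \<Gamma>" "f = section_cocycle G \<sigma>"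
proof -
  obtain \<sigma> where \<sigma>: "f = section_cocycle G \<sigma>"
    using two_cocycle_is_section_cocycle[OF f] .
  define \<Gamma> where "\<Gamma> = {(a, v). a \<in> G \<and> v - \<sigma> a \<in> L}"
  have fL: "f (a, b) \<in> L" if "a \<in> G" "b \<in> G" for a b
    using f that by (auto simp: cocycles_def PiE_def)
  have f\<sigma>: "\<sigma> a + a *v \<sigma> b = f (a, b) + \<sigma> (a ** b)" if "a \<in> G" "b \<in> G" for a b
    using that \<sigma> by (simp add: section_cocycle_apply)
  have \<sigma>1: "\<sigma> (mat 1) \<in> L"
    using section_at_one[of \<sigma> f, OF f\<sigma>] fL G_one by simp
  have mult: "(a ** b, v + a *v w) \<in> \<Gamma>" if "(a, v) \<in> \<Gamma>" "(b, w) \<in> \<Gamma>" for a b v w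
  proof -
    have ab: "a \<in> G" "b \<in> G" "v - \<sigma> a \<in> L" "w - \<sigma> b \<in> L"
      using that by (simp_all add: \<Gamma>_def)
    then have "(v - \<sigma> a) + a *v (w - \<sigma> b) + f (a, b) \<in> L"
      by (simp add: L_add L_act fL)
    also have "(v - \<sigma> a) + a *v (w - \<sigma> b) + f (a, b) = v + a *v w - \<sigma> (a ** b)"
      using f\<sigma>[OF ab(1,2)] by (simp add: matrix_vector_mult_diff_distrib algebra_simps)
    finally show ?thesis
      using ab by (simp add: \<Gamma>_def G_mult)
  qed
  have inv: "(matrix_inv a, - (matrix_inv a *v v)) \<in> \<Gamma>" if "(a, v) \<in> \<Gamma>" for a v
  proof -
    let ?b = "matrix_inv a"
    have ab: "a \<in> G" "?b \<in> G" "v - \<sigma> a \<in> L"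
      using that by (simp_all add: \<Gamma>_def G_inv)
    then have "- (?b *v (v - \<sigma> a)) - f (?b, a) - \<sigma> (mat 1) \<in> L"
      by (intro L_diff[OF L_diff[OF L_minus[OF L_act]]] fL \<sigma>1)
    also have "- (?b *v (v - \<sigma> a)) - f (?b, a) - \<sigma> (mat 1) = - (?b *v v) - \<sigma> ?b"
      using f\<sigma>[OF ab(2,1)] ab(1)
      by (simp add: matrix_vector_mult_diff_distrib matrix_inv_cancel G_invertible algebra_simps)
    finally show ?thesis
      using ab by (simp add: \<Gamma>_def)
  qed
  have one: "(mat 1, 0) \<in> \<Gamma>"
    by (simp add: \<Gamma>_def G_one L_minus \<sigma>1)
  have sub: "subgroup \<Gamma> isom_group"
  proof (rule group.subgroupI[OF group_isom_group])
    show "\<Gamma> \<subseteq> carrier isom_group"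
      using orthogonal by (auto simp: \<Gamma>_def isom_group_def)
    show "\<Gamma> \<noteq> {}"
      using one by blast
    show "x \<otimes>\<^bsub>isom_group\<^esub> y \<in> \<Gamma>" if "x \<in> \<Gamma>" "y \<in> \<Gamma>" for x y
      using mult that by (cases x; cases y) (simp add: isom_group_def)
    show "inv\<^bsub>isom_group\<^esub> x \<in> \<Gamma>" if x: "x \<in> \<Gamma>" for x
    proof -
      obtain a v where av: "x = (a, v)" "a \<in> G"
        using x by (auto simp: \<Gamma>_def)
      have inv_x: "(matrix_inv a, - (matrix_inv a *v v)) \<in> \<Gamma>"
        using inv x av by simp
      have "inv\<^bsub>isom_group\<^esub> x = (matrix_inv a, - (matrix_inv a *v v))"
      proof (rule group.inv_equality[OF group_isom_group])
        show "(matrix_inv a, - (matrix_inv a *v v)) \<otimes>\<^bsub>isom_group\<^esub> x = \<one>\<^bsub>isom_group\<^esub>"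
          using av by (simp add: isom_group_def matrix_inv_cancel G_invertible)
        show "x \<in> carrier isom_group" "(matrix_inv a, - (matrix_inv a *v v)) \<in> carrier isom_group"
          using av(2) orthogonal G_inv by (auto simp: isom_group_def av(1))
      qed
      with inv_x show ?thesis
        by simp
    qed
  qed
  have "discrete \<Gamma>"
  proof (rule discreteI)
    fix \<gamma> assume "\<gamma> \<in> \<Gamma>"
    have "\<Gamma> \<inter> ball \<gamma> 1 \<subseteq>
      (\<Union>a\<in>G. (\<lambda>l. (a, l + \<sigma> a)) ` (L \<inter> cball 0 (1 + norm (snd \<gamma>) + norm (\<sigma> a))))"
    proof
      fix \<delta> assume "\<delta> \<in> \<Gamma> \<inter> ball \<gamma> 1"
      then obtain a v where \<delta>: "\<delta> = (a, v)" "a \<in> G" "v - \<sigma> a \<in> L" "dist \<gamma> (a, v) < 1"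
        by (auto simp: \<Gamma>_def)
      have "norm (v - snd \<gamma>) < 1"
        using dist_snd_le[of \<gamma> "(a, v)"] \<delta>(4) by (simp add: dist_norm norm_minus_commute)
      then have "norm (v - \<sigma> a) \<le> 1 + norm (snd \<gamma>) + norm (\<sigma> a)"
        using norm_triangle_ineq4[of v "\<sigma> a"] norm_triangle_ineq2[of v "snd \<gamma>"] by linarith
      then show "\<delta> \<in> (\<Union>a\<in>G. (\<lambda>l. (a, l + \<sigma> a)) ` (L \<inter> cball 0 (1 + norm (snd \<gamma>) + norm (\<sigma> a))))"
        using \<delta> by (intro UN_I[of a] image_eqI[of _ _ "v - \<sigma> a"]) auto
    qed
    moreover have "finite (\<Union>a\<in>G. (\<lambda>l. (a, l + \<sigma> a)) ` (L \<inter> cball 0 (1 + norm (snd \<gamma>) + norm (\<sigma> a))))"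
      using finite_G lattice_locally_finite[OF lattice] by blast
    ultimately have "\<not> \<gamma> islimpt \<Gamma>"
      unfolding islimpt_eq_infinite_ball using finite_subset zero_less_one by blast
    with \<open>\<gamma> \<in> \<Gamma>\<close> show "\<gamma> isolated_in \<Gamma>"
      by (simp add: isolated_in_islimpt_iff)
  qed
  moreover have "compact_space (orbit_space \<Gamma>)"
  proof -
    obtain R where R: "\<And>x. \<exists>l\<in>L. norm (x + l) \<le> R"
      using lattice_cobounded[OF lattice] by blast
    have "orbit_of \<Gamma> x \<in> orbit_of \<Gamma> ` cball 0 R" for x
    proof -
      obtain l where l: "l \<in> L" "norm (x + l) \<le> R"
        using R by blast
      have "(mat 1, l) \<in> \<Gamma>"
        using l(1) by (simp add: \<Gamma>_def G_one L_diff \<sigma>1)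
      then have "orbit_of \<Gamma> (x + l) = orbit_of \<Gamma> x"
        using orbit_of_act_eq[OF sub, of "(mat 1, l)" x] by simp
      with l(2) show ?thesis
        by (intro image_eqI[of _ _ "x + l"]) auto
    qed
    then have "orbit_of \<Gamma> ` cball 0 R = topspace (orbit_space \<Gamma>)"
      by (auto simp: topspace_orbit_space)
    moreover have "compactin (orbit_space \<Gamma>) (orbit_of \<Gamma> ` cball 0 R)"
      by (rule image_compactin[OF _ quotient_imp_continuous_map[OF quotient_map_orbit_of]])
        (simp add: compactin_euclidean_iff)
    ultimately show ?thesis
      by (simp add: compact_space_def)
  qed
  moreover have "torsion_free (isom_group\<lparr>carrier := \<Gamma>\<rparr>)"
  proof (rule torsion_free_transfer[OF tf, where \<psi> = "\<lambda>(a, v). (a, v - \<sigma> a)"])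
    show "x \<otimes>\<^bsub>isom_group\<lparr>carrier := \<Gamma>\<rparr>\<^esub> y \<in> carrier (isom_group\<lparr>carrier := \<Gamma>\<rparr>)"
      if "x \<in> carrier (isom_group\<lparr>carrier := \<Gamma>\<rparr>)" "y \<in> carrier (isom_group\<lparr>carrier := \<Gamma>\<rparr>)" for x y
      using that subgroup.m_closed[OF sub] by simp
    show "\<one>\<^bsub>isom_group\<lparr>carrier := \<Gamma>\<rparr>\<^esub> \<in> carrier (isom_group\<lparr>carrier := \<Gamma>\<rparr>)"
      using subgroup.one_closed[OF sub] by simp
    show "(case \<one>\<^bsub>isom_group\<lparr>carrier := \<Gamma>\<rparr>\<^esub> of (a, v) \<Rightarrow> (a, v - \<sigma> a)) = \<one>\<^bsub>cocycle_extension G L f\<^esub>"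
      using section_at_one[of \<sigma> f, OF f\<sigma>] by (simp add: cocycle_extension_def isom_group_def)
    show "(case x \<otimes>\<^bsub>isom_group\<lparr>carrier := \<Gamma>\<rparr>\<^esub> y of (a, v) \<Rightarrow> (a, v - \<sigma> a))
        = (case x of (a, v) \<Rightarrow> (a, v - \<sigma> a)) \<otimes>\<^bsub>cocycle_extension G L f\<^esub> (case y of (a, v) \<Rightarrow> (a, v - \<sigma> a))"
      if "x \<in> carrier (isom_group\<lparr>carrier := \<Gamma>\<rparr>)" "y \<in> carrier (isom_group\<lparr>carrier := \<Gamma>\<rparr>)" for x y
    proof -
      obtain a v b w where xy: "x = (a, v)" "a \<in> G" "y = (b, w)" "b \<in> G"
        using \<open>x \<in> _\<close> \<open>y \<in> _\<close> by (auto simp: \<Gamma>_def)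
      show ?thesis
        using f\<sigma>[OF xy(2,4)]
        by (simp add: xy(1,3) cocycle_extension_def isom_group_def
            matrix_vector_mult_diff_distrib algebra_simps)
    qed
    show "(case x of (a, v) \<Rightarrow> (a, v - \<sigma> a)) \<in> carrier (cocycle_extension G L f)"
      if "x \<in> carrier (isom_group\<lparr>carrier := \<Gamma>\<rparr>)" for x
      using that by (auto simp: cocycle_extension_def \<Gamma>_def)
    show "inj_on (\<lambda>(a, v). (a, v - \<sigma> a)) (carrier (isom_group\<lparr>carrier := \<Gamma>\<rparr>))"
      by (auto simp: inj_on_def)
  qed
  moreover have "translation_lattice \<Gamma> = L"
  proof -
    have "l - \<sigma> (mat 1) \<in> L \<longleftrightarrow> l \<in> L" for l
      using L_add[of "l - \<sigma> (mat 1)" "\<sigma> (mat 1)"] L_diff[of l] \<sigma>1 by auto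
    then show ?thesis
      by (simp add: translation_lattice_def \<Gamma>_def G_one)
  qed
  moreover have \<sigma>\<Gamma>: "(a, \<sigma> a) \<in> \<Gamma>" if "a \<in> G" for a
    using that by (simp add: \<Gamma>_def L_zero)
  then have "G \<subseteq> fst ` \<Gamma>"
    by (metis fst_conv image_eqI subsetI)
  then have "holonomy_group \<Gamma> = G"
    by (auto simp: holonomy_group_def \<Gamma>_def)
  ultimately have "\<Gamma> \<in> bieberbach_groups L G"
    using sub by (simp add: bieberbach_groups_def bieberbach_group_def)
  moreover have "\<sigma> \<in> sections \<Gamma>"
    using \<sigma>\<Gamma> by (simp add: sections_def)
  ultimately show ?thesis
    using \<sigma> that by blast
qed

lemma special_class_realized:
  assumes "c \<in> special_classes G L"
  obtains \<Gamma> where "\<Gamma> \<in> bieberbach_groups L G" "extension_class G L \<Gamma> = c"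
proof -
  obtain f where f: "f \<in> cocycles G L" and c: "c = coboundaries G L #>\<^bsub>cocycle_group G L\<^esub> f"
    using assms by (auto simp: special_classes_def H2_def FactGroup_def RCOSETS_def cocycle_group_def)
  have "(\<lambda>(a, b)\<in>G \<times> G. 0) \<in> coboundaries G L"
    unfolding coboundaries_def using L_zero by (intro CollectI exI[of _ "\<lambda>_. 0"]) auto
  moreover have "f = (\<lambda>(a, b)\<in>G \<times> G. 0) \<otimes>\<^bsub>cocycle_group G L\<^esub> f"
    using f by (auto simp: cocycle_group_def fun_eq_iff cocycles_def PiE_def extensional_def)
  ultimately have "f \<in> c"
    unfolding c r_coset_def by blast
  then have "torsion_free (cocycle_extension G L f)"
    using assms by (simp add: special_classes_def)
  then obtain \<Gamma> \<sigma> where "\<Gamma> \<in> bieberbach_groups L G" "\<sigma> \<in> sections \<Gamma>" "f = section_cocycle G \<sigma>"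
    using bieberbach_group_of_cocycle[OF f] by blast
  with extension_class_coset c that show ?thesis
    by metis
qed

end

section \<open>The action of the normalizer\<close>

lemma conjugate_cancel:
  fixes A :: "real^'n^'n"
  assumes "invertible A"
  shows "A ** (matrix_inv A ** g ** A) ** matrix_inv A = g"
    "matrix_inv A ** (A ** g ** matrix_inv A) ** A = g"
  using assms matrix_inv_cancel(1,2)[OF assms]
  by (metis matrix_mul_assoc matrix_mul_lid matrix_mul_rid)+

text \<open>The inclusions for \<open>A\<close> and for its inverse together amount to the equalities in the
  definition.\<close>

lemma lattice_normalizer_iff:
  "A \<in> lattice_normalizer L G \<longleftrightarrow> invertible A \<and>
     (\<forall>l\<in>L. A *v l \<in> L \<and> matrix_inv A *v l \<in> L) \<and>
     (\<forall>g\<in>G. A ** g ** matrix_inv A \<in> G \<and> matrix_inv A ** g ** A \<in> G)"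
  (is "_ \<longleftrightarrow> ?rhs")
proof
  assume "A \<in> lattice_normalizer L G"
  then have A: "invertible A" "(*v) A ` L = L" "(*v) (matrix_inv A) ` L = L"
    and conj: "(\<lambda>g. A ** g ** matrix_inv A) ` G = G"
    by (auto simp: lattice_normalizer_def GL_lattice_def)
  have "matrix_inv A ** g ** A \<in> G" if "g \<in> G" for g
  proof -
    have "g \<in> (\<lambda>g. A ** g ** matrix_inv A) ` G"
      using conj that by simp
    then obtain h where h: "h \<in> G" "g = A ** h ** matrix_inv A"
      by blast
    then show ?thesis
      using conjugate_cancel(2)[OF A(1)] by simp
  qed
  with A conj show ?rhs
    by blast
next
  assume rhs: ?rhs
  have "l \<in> (*v) A ` L \<and> l \<in> (*v) (matrix_inv A) ` L" if "l \<in> L" for l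
    using rhs that by (metis image_eqI matrix_inv_cancel(3,4))
  moreover have "g \<in> (\<lambda>g. A ** g ** matrix_inv A) ` G" if "g \<in> G" for g
    using rhs that conjugate_cancel(1)[of A g] by (intro image_eqI[of _ _ "matrix_inv A ** g ** A"]) simp_all
  ultimately show "A \<in> lattice_normalizer L G"
    using rhs unfolding lattice_normalizer_def GL_lattice_def by blast
qed

lemma lattice_normalizer_inv:
  assumes "A \<in> lattice_normalizer L G"
  shows "matrix_inv A \<in> lattice_normalizer L G"
  using assms unfolding lattice_normalizer_iff
  by (simp add: invertible_matrix_inv)

lemma lattice_normalizer_mult:
  assumes "A \<in> lattice_normalizer L G" "B \<in> lattice_normalizer L G"
  shows "A ** B \<in> lattice_normalizer L G"
proof -
  have "A ** B ** g ** (matrix_inv B ** matrix_inv A) = A ** (B ** g ** matrix_inv B) ** matrix_inv A"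
    "matrix_inv B ** matrix_inv A ** g ** (A ** B) = matrix_inv B ** (matrix_inv A ** g ** A) ** B" for g
    by (simp_all add: matrix_mul_assoc)
  with assms show ?thesis
    unfolding lattice_normalizer_iff
    by (simp add: matrix_inv_mult invertible_mult flip: matrix_vector_mul_assoc)
qed

lemma cocycle_action_apply:
  "a \<in> G \<Longrightarrow> b \<in> G \<Longrightarrow>
     cocycle_action G A f (a, b) = A *v f (matrix_inv A ** a ** A, matrix_inv A ** b ** A)"
  by (simp add: cocycle_action_def)

lemma cocycle_action_mult:
  assumes "A \<in> lattice_normalizer L G" "B \<in> lattice_normalizer L G"
  shows "cocycle_action G A (cocycle_action G B f) = cocycle_action G (A ** B) f"
proof (rule extensionalityI)
  show "cocycle_action G A (cocycle_action G B f) \<in> extensional (G \<times> G)"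
    "cocycle_action G (A ** B) f \<in> extensional (G \<times> G)"
    by (simp_all add: cocycle_action_def)
  fix p assume "p \<in> G \<times> G"
  then obtain a b where p: "p = (a, b)" "a \<in> G" "b \<in> G"
    by blast
  have "matrix_inv (A ** B) = matrix_inv B ** matrix_inv A"
    using assms by (intro matrix_inv_mult) (simp_all add: lattice_normalizer_iff)
  moreover have "matrix_inv A ** a ** A \<in> G" "matrix_inv A ** b ** A \<in> G"
    using assms(1) p by (simp_all add: lattice_normalizer_iff)
  ultimately show "cocycle_action G A (cocycle_action G B f) p = cocycle_action G (A ** B) f p"
    using p by (simp add: cocycle_action_apply matrix_mul_assoc matrix_vector_mul_assoc)
qed

lemma class_action_mult:
  assumes "A \<in> lattice_normalizer L G" "B \<in> lattice_normalizer L G"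
  shows "class_action G A (class_action G B c) = class_action G (A ** B) c"
  unfolding class_action_def image_image cocycle_action_mult[OF assms] ..

lemma class_action_one:
  assumes "c \<subseteq> cocycles G L"
  shows "class_action G (mat 1) c = c"
proof -
  have "cocycle_action G (mat 1) f = f" if "f \<in> c" for f
  proof (rule extensionalityI)
    show "cocycle_action G (mat 1) f \<in> extensional (G \<times> G)"
      by (simp add: cocycle_action_def)
    show "f \<in> extensional (G \<times> G)"
      using assms that cocycles_extensional by blast
    show "cocycle_action G (mat 1) f p = f p" if "p \<in> G \<times> G" for p
      using that by (auto simp: cocycle_action_apply matrix_inv_one)
  qed
  then show ?thesis
    by (simp add: class_action_def)
qed

lemma complex_normalizer_carrier:
  "A \<in> carrier (complex_normalizer L G J) \<longleftrightarrow> A \<in> lattice_normalizer L G \<and> A ** J = J ** A"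
  by (simp add: complex_normalizer_def)

lemma complex_normalizer_inv:
  assumes "A \<in> carrier (complex_normalizer L G J)"
  shows "matrix_inv A \<in> carrier (complex_normalizer L G J)"
proof -
  have "invertible A" "A ** J = J ** A"
    using assms by (simp_all add: complex_normalizer_carrier lattice_normalizer_iff)
  then have "matrix_inv A ** J = J ** matrix_inv A"
    by (metis matrix_inv_cancel(1,2) matrix_mul_assoc matrix_mul_lid matrix_mul_rid)
  with assms show ?thesis
    by (simp add: complex_normalizer_carrier lattice_normalizer_inv)
qed

lemma complex_normalizer_mult:
  assumes "A \<in> carrier (complex_normalizer L G J)" "B \<in> carrier (complex_normalizer L G J)"
  shows "A ** B \<in> carrier (complex_normalizer L G J)"
  using assms unfolding complex_normalizer_carrier
  by (metis lattice_normalizer_mult matrix_mul_assoc)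

lemma complex_normalizer_one: "mat 1 \<in> carrier (complex_normalizer L G J)"
  by (simp add: complex_normalizer_carrier lattice_normalizer_iff matrix_inv_eqI[of "mat 1" "mat 1"])

lemma class_orbit_eq_iff:
  fixes L :: "(real^'n) set" and G :: "(real^'n^'n) set" and J :: "real^'n^'n"
  assumes "c \<subseteq> cocycles G L" "d \<subseteq> cocycles G L"
  defines "N \<equiv> complex_normalizer L G J"
  shows "orbit N (class_action G) c = orbit N (class_action G) d \<longleftrightarrow>
    (\<exists>A\<in>carrier N. class_action G A c = d)"
proof
  assume "orbit N (class_action G) c = orbit N (class_action G) d"
  moreover have "d \<in> orbit N (class_action G) d"
    using class_action_one[OF assms(2)] complex_normalizer_one unfolding orbit_def N_def
    by (metis (mono_tags, lifting) mem_Collect_eq)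
  ultimately have "d \<in> orbit N (class_action G) c"
    by simp
  then show "\<exists>A\<in>carrier N. class_action G A c = d"
    by (auto simp: orbit_def)
next
  assume "\<exists>A\<in>carrier N. class_action G A c = d"
  then obtain A where A: "A \<in> carrier N" and d: "d = class_action G A c"
    by blast
  note norm = A[unfolded N_def complex_normalizer_carrier, THEN conjunct1]
  have "class_action G B d = class_action G (B ** A) c" if "B \<in> carrier N" for B
    unfolding d using that norm by (intro class_action_mult) (simp_all add: N_def complex_normalizer_carrier)
  moreover have "class_action G B c = class_action G (B ** matrix_inv A) d" if B: "B \<in> carrier N" for B
  proof -
    have "class_action G (B ** matrix_inv A) d = class_action G (B ** matrix_inv A ** A) c"
      unfolding d using B norm
      by (intro class_action_mult lattice_normalizer_mult lattice_normalizer_inv)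
        (simp_all add: N_def complex_normalizer_carrier)
    also have "B ** matrix_inv A ** A = B"
      using norm by (simp add: lattice_normalizer_iff matrix_inv_cancel flip: matrix_mul_assoc)
    finally show ?thesis ..
  qed
  moreover have "B ** A \<in> carrier N" "B ** matrix_inv A \<in> carrier N" if "B \<in> carrier N" for B
    using that A unfolding N_def by (blast intro: complex_normalizer_mult complex_normalizer_inv)+
  ultimately show "orbit N (class_action G) c = orbit N (class_action G) d"
    unfolding orbit_def by (intro Collect_cong) metis
qed

text \<open>Conjugation by \<open>x \<mapsto> A x + a\<close> takes the translation by \<open>l\<close> to the translation by \<open>A l\<close> and acts on
  linear parts by conjugation with \<open>A\<close>. The inverse conjugation gives the same for the inverse of \<open>A\<close>.\<close>

lemma affine_conj_lattice_normalizer: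
  assumes "\<Gamma>\<^sub>1 \<in> bieberbach_groups L G" "\<Gamma>\<^sub>2 \<in> bieberbach_groups L G"
    and A: "invertible A" and conj: "affine_conj A a ` \<Gamma>\<^sub>1 = \<Gamma>\<^sub>2"
  shows "A \<in> lattice_normalizer L G"
proof -
  have step: "(\<forall>l\<in>L. B *v l \<in> L) \<and> (\<forall>g\<in>G. B ** g ** matrix_inv B \<in> G)"
    if B: "invertible B" and \<Gamma>: "\<Gamma> \<in> bieberbach_groups L G" "\<Gamma>' \<in> bieberbach_groups L G"
      and conj: "affine_conj B b ` \<Gamma> = \<Gamma>'" for B b \<Gamma> \<Gamma>'
  proof (intro conjI ballI)
    fix l assume "l \<in> L"
    then have "(mat 1, l) \<in> \<Gamma>"
      using \<Gamma>(1) by (auto simp: bieberbach_groups_def translation_lattice_def)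
    then have "affine_conj B b (mat 1, l) \<in> \<Gamma>'"
      using conj by blast
    moreover have "affine_conj B b (mat 1, l) = (mat 1, B *v l)"
      using B by (simp add: affine_conj_def matrix_inv_cancel)
    ultimately show "B *v l \<in> L"
      using \<Gamma>(2) by (auto simp: bieberbach_groups_def translation_lattice_def)
  next
    fix g assume "g \<in> G"
    then obtain v where "(g, v) \<in> \<Gamma>"
      using \<Gamma>(1) by (auto simp: bieberbach_groups_def holonomy_group_def)
    then have "affine_conj B b (g, v) \<in> \<Gamma>'"
      using conj by blast
    then have "fst (affine_conj B b (g, v)) \<in> G"
      using \<Gamma>(2) by (auto simp: bieberbach_groups_def holonomy_group_def)
    then show "B ** g ** matrix_inv B \<in> G"
      by (simp add: affine_conj_def)
  qed
  have "affine_conj (matrix_inv A) (- (matrix_inv A *v a)) ` \<Gamma>\<^sub>2 = \<Gamma>\<^sub>1"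
    unfolding conj[symmetric] by (simp add: image_image affine_conj_inverse[OF A])
  from step[OF invertible_matrix_inv(1)[OF A] assms(2,1) this] step[OF A assms(1,2) conj]
  show ?thesis
    using A by (simp add: lattice_normalizer_iff invertible_matrix_inv)
qed

context holonomy_representation
begin

text \<open>The term \<open>a - c *v a\<close> is the coboundary of a constant, so it has no influence on the
  cocycle. Including it makes the right-hand section the conjugate of the section \<open>\<sigma>\<close> by the affine
  map \<open>x \<mapsto> A x + a\<close>.\<close>

lemma cocycle_action_section:
  assumes A: "A \<in> lattice_normalizer L G"
  shows "cocycle_action G A (section_cocycle G \<sigma>) =
    section_cocycle G (\<lambda>c. A *v \<sigma> (matrix_inv A ** c ** A) + (a - c *v a))"
proof (rule section_cocycle_eqI)
  show "cocycle_action G A (section_cocycle G \<sigma>) \<in> extensional (G \<times> G)"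
    by (simp add: cocycle_action_def)
  fix c d assume cd: "c \<in> G" "d \<in> G"
  let ?c = "\<lambda>c. matrix_inv A ** c ** A"
  have inv: "invertible A"
    using A by (simp add: lattice_normalizer_iff)
  have G: "?c c \<in> G" "?c d \<in> G"
    using A cd by (simp_all add: lattice_normalizer_iff)
  have mult: "?c c ** ?c d = ?c (c ** d)"
  proof -
    have "?c c ** ?c d = matrix_inv A ** c ** (A ** matrix_inv A) ** d ** A"
      by (simp only: matrix_mul_assoc)
    then show ?thesis
      using inv by (simp add: matrix_inv_cancel matrix_mul_assoc)
  qed
  have "A ** ?c c = (A ** matrix_inv A) ** c ** A"
    by (simp only: matrix_mul_assoc)
  then have Ac: "A *v (?c c *v x) = c *v (A *v x)" for x
    using inv by (simp add: matrix_inv_cancel matrix_vector_mul_assoc)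
  have "cocycle_action G A (section_cocycle G \<sigma>) (c, d)
      = A *v (\<sigma> (?c c) + ?c c *v \<sigma> (?c d) - \<sigma> (?c (c ** d)))"
    by (simp only: cocycle_action_apply[OF cd] section_cocycle_apply[OF G] mult)
  also have "\<dots> = A *v \<sigma> (?c c) + c *v (A *v \<sigma> (?c d)) - A *v \<sigma> (?c (c ** d))"
    by (simp only: matrix_vector_right_distrib matrix_vector_mult_diff_distrib Ac)
  finally show "cocycle_action G A (section_cocycle G \<sigma>) (c, d)
      = A *v \<sigma> (?c c) + (a - c *v a) + c *v (A *v \<sigma> (?c d) + (a - d *v a))
        - (A *v \<sigma> (?c (c ** d)) + (a - (c ** d) *v a))"
    by (simp add: matrix_vector_right_distrib matrix_vector_mult_diff_distrib
        matrix_vector_mul_assoc algebra_simps)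
qed

lemma class_action_extension_class_subset:
  assumes \<Gamma>: "\<Gamma>\<^sub>1 \<in> bieberbach_groups L G" "\<Gamma>\<^sub>2 \<in> bieberbach_groups L G"
    and A: "invertible A" and conj: "affine_conj A a ` \<Gamma>\<^sub>1 = \<Gamma>\<^sub>2"
  shows "class_action G A (extension_class G L \<Gamma>\<^sub>1) \<subseteq> extension_class G L \<Gamma>\<^sub>2"
proof
  have N: "A \<in> lattice_normalizer L G"
    by (rule affine_conj_lattice_normalizer[OF \<Gamma> A conj])
  fix f assume "f \<in> class_action G A (extension_class G L \<Gamma>\<^sub>1)"
  then obtain \<sigma> where \<sigma>: "\<sigma> \<in> sections \<Gamma>\<^sub>1" "f = cocycle_action G A (section_cocycle G \<sigma>)"
    by (auto simp: class_action_def extension_class_eq[OF \<Gamma>(1)])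
  let ?\<tau> = "\<lambda>c. A *v \<sigma> (matrix_inv A ** c ** A) + (a - c *v a)"
  have "(c, ?\<tau> c) \<in> \<Gamma>\<^sub>2" if c: "c \<in> G" for c
  proof -
    have "matrix_inv A ** c ** A \<in> G"
      using N c by (simp add: lattice_normalizer_iff)
    then have "affine_conj A a (matrix_inv A ** c ** A, \<sigma> (matrix_inv A ** c ** A)) \<in> \<Gamma>\<^sub>2"
      using \<sigma>(1) conj by (auto simp: sections_def)
    then show ?thesis
      by (simp add: affine_conj_def conjugate_cancel[OF A] add_diff_eq)
  qed
  then have "?\<tau> \<in> sections \<Gamma>\<^sub>2"
    by (simp add: sections_def)
  then show "f \<in> extension_class G L \<Gamma>\<^sub>2"
    unfolding \<sigma>(2) cocycle_action_section[OF N, of \<sigma> a] extension_class_eq[OF \<Gamma>(2)] by blast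
qed

lemma extension_class_subset_cocycles: "extension_class G L \<Gamma> \<subseteq> cocycles G L"
  by (auto simp: extension_class_def)

lemma affine_conj_imp_class_action:
  assumes \<Gamma>: "\<Gamma>\<^sub>1 \<in> bieberbach_groups L G" "\<Gamma>\<^sub>2 \<in> bieberbach_groups L G"
    and A: "invertible A" and conj: "affine_conj A a ` \<Gamma>\<^sub>1 = \<Gamma>\<^sub>2"
  shows "class_action G A (extension_class G L \<Gamma>\<^sub>1) = extension_class G L \<Gamma>\<^sub>2"
proof
  show "class_action G A (extension_class G L \<Gamma>\<^sub>1) \<subseteq> extension_class G L \<Gamma>\<^sub>2"
    by (rule class_action_extension_class_subset[OF assms])
  have N: "A \<in> lattice_normalizer L G"
    by (rule affine_conj_lattice_normalizer[OF assms])
  have "affine_conj (matrix_inv A) (- (matrix_inv A *v a)) ` \<Gamma>\<^sub>2 = \<Gamma>\<^sub>1"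
    unfolding conj[symmetric] by (simp add: image_image affine_conj_inverse[OF A])
  from class_action_extension_class_subset[OF \<Gamma>(2,1) invertible_matrix_inv(1)[OF A] this]
  have "class_action G A (class_action G (matrix_inv A) (extension_class G L \<Gamma>\<^sub>2))
      \<subseteq> class_action G A (extension_class G L \<Gamma>\<^sub>1)"
    unfolding class_action_def by (rule image_mono)
  then show "extension_class G L \<Gamma>\<^sub>2 \<subseteq> class_action G A (extension_class G L \<Gamma>\<^sub>1)"
    by (simp add: class_action_mult[OF N lattice_normalizer_inv[OF N]] matrix_inv_cancel A
        class_action_one[OF extension_class_subset_cocycles])
qed

text \<open>Sections of the two groups with the same cocycle, after applying \<open>A\<close> to the first, differ by a
  1-cocycle with values in \<open>\<real>\<^sup>n\<close>. It is the coboundary of a vector \<open>w\<close>, and the translation by \<open>- w\<close>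
  makes the conjugated section agree with the other one.\<close>

lemma class_action_imp_affine_conj:
  assumes \<Gamma>: "\<Gamma>\<^sub>1 \<in> bieberbach_groups L G" "\<Gamma>\<^sub>2 \<in> bieberbach_groups L G"
    and N: "A \<in> lattice_normalizer L G"
    and eq: "class_action G A (extension_class G L \<Gamma>\<^sub>1) = extension_class G L \<Gamma>\<^sub>2"
  obtains a where "affine_conj A a ` \<Gamma>\<^sub>1 = \<Gamma>\<^sub>2"
proof -
  have A: "invertible A"
    using N by (simp add: lattice_normalizer_iff)
  let ?c = "\<lambda>c. matrix_inv A ** c ** A"
  obtain \<sigma> where \<sigma>: "\<sigma> \<in> sections \<Gamma>\<^sub>1"
    using sections_nonempty[OF \<Gamma>(1)] .
  then have "cocycle_action G A (section_cocycle G \<sigma>) \<in> section_cocycle G ` sections \<Gamma>\<^sub>2"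
    using eq by (auto simp: class_action_def extension_class_eq \<Gamma>)
  then obtain \<tau> where \<tau>: "\<tau> \<in> sections \<Gamma>\<^sub>2"
    "cocycle_action G A (section_cocycle G \<sigma>) = section_cocycle G \<tau>"
    by blast
  let ?\<rho> = "\<lambda>c. A *v \<sigma> (?c c)"
  have "section_cocycle G ?\<rho> = section_cocycle G \<tau>"
    using \<tau>(2) cocycle_action_section[OF N, of \<sigma> 0] by simp
  then have \<rho>: "?\<rho> c + c *v ?\<rho> d - ?\<rho> (c ** d) = \<tau> c + c *v \<tau> d - \<tau> (c ** d)"
    if "c \<in> G" "d \<in> G" for c d
    using that section_cocycle_apply[of _ G _ ?\<rho>] section_cocycle_apply[of _ G _ \<tau>] by metis
  obtain w where w: "\<And>c. c \<in> G \<Longrightarrow> ?\<rho> c - \<tau> c = w - c *v w"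
  proof (rule one_cocycle_is_coboundary[of "\<lambda>c. ?\<rho> c - \<tau> c"])
    fix c d assume "c \<in> G" "d \<in> G"
    from \<rho>[OF this] show "?\<rho> (c ** d) - \<tau> (c ** d) = (?\<rho> c - \<tau> c) + c *v (?\<rho> d - \<tau> d)"
      by (simp add: matrix_vector_mult_diff_distrib algebra_simps)
  qed blast
  have conj: "affine_conj A (- w) (g, v) = (A ** g ** matrix_inv A, A *v (v - \<sigma> g) + \<tau> (A ** g ** matrix_inv A))"
    if g: "g \<in> G" for g v
  proof -
    let ?h = "A ** g ** matrix_inv A"
    have h: "?h \<in> G"
      using N g by (simp add: lattice_normalizer_iff)
    have "A *v \<sigma> g = \<tau> ?h + (w - ?h *v w)"
      using w[OF h] by (simp add: conjugate_cancel[OF A] algebra_simps)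
    then show ?thesis
      by (simp add: affine_conj_def matrix_vector_mult_diff_distrib vec.neg)
  qed
  have "affine_conj A (- w) ` \<Gamma>\<^sub>1 = \<Gamma>\<^sub>2"
  proof (intro equalityI subsetI)
    fix \<delta> assume "\<delta> \<in> affine_conj A (- w) ` \<Gamma>\<^sub>1"
    then obtain g v where gv: "\<delta> = affine_conj A (- w) (g, v)" "(g, v) \<in> \<Gamma>\<^sub>1"
      by auto
    then have g: "g \<in> G" "v - \<sigma> g \<in> L"
      using bieberbach_mem_iff[OF \<Gamma>(1) \<sigma>] by simp_all
    then show "\<delta> \<in> \<Gamma>\<^sub>2"
      using N unfolding gv(1) conj[OF g(1)] bieberbach_mem_iff[OF \<Gamma>(2) \<tau>(1)]
      by (simp add: lattice_normalizer_iff)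
  next
    fix \<delta> assume \<delta>: "\<delta> \<in> \<Gamma>\<^sub>2"
    obtain h v where hv: "\<delta> = (h, v)"
      by (cases \<delta>)
    then have h: "h \<in> G" "v - \<tau> h \<in> L"
      using \<delta> bieberbach_mem_iff[OF \<Gamma>(2) \<tau>(1)] by simp_all
    then have g: "?c h \<in> G" "matrix_inv A *v (v - \<tau> h) \<in> L"
      using N by (simp_all add: lattice_normalizer_iff)
    let ?\<gamma> = "(?c h, matrix_inv A *v (v - \<tau> h) + \<sigma> (?c h))"
    have "?\<gamma> \<in> \<Gamma>\<^sub>1"
      using g bieberbach_mem_iff[OF \<Gamma>(1) \<sigma>] by simp
    moreover have "affine_conj A (- w) ?\<gamma> = \<delta>"
      unfolding conj[OF g(1)] hv by (simp add: conjugate_cancel[OF A] matrix_inv_cancel[OF A])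
    ultimately show "\<delta> \<in> affine_conj A (- w) ` \<Gamma>\<^sub>1"
      by blast
  qed
  with that show ?thesis
    by blast
qed

lemma biholomorphic_iff_class_action:
  assumes \<Gamma>: "\<Gamma>\<^sub>1 \<in> bieberbach_groups L G" "\<Gamma>\<^sub>2 \<in> bieberbach_groups L G"
    and J: "J ** J = - mat 1" "\<forall>g\<in>G. J ** g = g ** J"
  shows "biholomorphic J (flat_manifold \<Gamma>\<^sub>1) (flat_manifold \<Gamma>\<^sub>2) \<longleftrightarrow>
    (\<exists>A\<in>carrier (complex_normalizer L G J).
       class_action G A (extension_class G L \<Gamma>\<^sub>1) = extension_class G L \<Gamma>\<^sub>2)"
proof
  assume "biholomorphic J (flat_manifold \<Gamma>\<^sub>1) (flat_manifold \<Gamma>\<^sub>2)"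
  then obtain A a where A: "invertible A" "A ** J = J ** A" "affine_conj A a ` \<Gamma>\<^sub>1 = \<Gamma>\<^sub>2"
    using biholomorphic_imp_affine_conj[OF \<Gamma>[THEN bieberbachI] J(1)] by metis
  then have "A \<in> carrier (complex_normalizer L G J)"
    using affine_conj_lattice_normalizer[OF \<Gamma>] by (simp add: complex_normalizer_carrier)
  with affine_conj_imp_class_action[OF \<Gamma> A(1,3)]
  show "\<exists>A\<in>carrier (complex_normalizer L G J).
      class_action G A (extension_class G L \<Gamma>\<^sub>1) = extension_class G L \<Gamma>\<^sub>2"
    by blast
next
  assume "\<exists>A\<in>carrier (complex_normalizer L G J).
      class_action G A (extension_class G L \<Gamma>\<^sub>1) = extension_class G L \<Gamma>\<^sub>2"
  then obtain A where A: "A \<in> lattice_normalizer L G" "A ** J = J ** A"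
    and eq: "class_action G A (extension_class G L \<Gamma>\<^sub>1) = extension_class G L \<Gamma>\<^sub>2"
    by (auto simp: complex_normalizer_carrier)
  obtain a where "affine_conj A a ` \<Gamma>\<^sub>1 = \<Gamma>\<^sub>2"
    using class_action_imp_affine_conj[OF \<Gamma> A(1) eq] .
  then show "biholomorphic J (flat_manifold \<Gamma>\<^sub>1) (flat_manifold \<Gamma>\<^sub>2)"
    using A by (intro affine_conj_imp_biholomorphic[OF \<Gamma>[THEN bieberbachI] _ _ _ J(2)])
      (simp_all add: lattice_normalizer_iff)
qed

end

section \<open>The classification\<close>

text \<open>A complete invariant of the members of a family descends to their classes. It is computed from
  the parameter \<open>x\<close> rather than from the member \<open>m x\<close>, as extension classes are computed from groups
  rather than from manifolds.\<close>

lemma quotient_bij_betw_invariant: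
  assumes rel: "\<And>x y. x \<in> X \<Longrightarrow> y \<in> X \<Longrightarrow> (m x, m y) \<in> r \<longleftrightarrow> e x = e y"
    and r: "r \<subseteq> m ` X \<times> m ` X"
  shows "\<exists>\<Phi>. bij_betw \<Phi> ((m ` X) // r) (e ` X) \<and> (\<forall>x\<in>X. \<Phi> (r `` {m x}) = e x)"
proof -
  define \<Phi> where "\<Phi> C = e (SOME y. y \<in> X \<and> m y \<in> C)" for C
  have \<Phi>: "\<Phi> (r `` {m x}) = e x" if x: "x \<in> X" for x
  proof -
    let ?y = "SOME y. y \<in> X \<and> m y \<in> r `` {m x}"
    have "x \<in> X \<and> m x \<in> r `` {m x}"
      using rel x by simp
    then have "?y \<in> X \<and> m ?y \<in> r `` {m x}"
      by (rule someI)
    then have "e ?y = e x"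
      using rel[OF x] by (metis Image_singleton_iff)
    then show ?thesis
      by (simp add: \<Phi>_def)
  qed
  have class_eq: "r `` {m x} = r `` {m y}" if xy: "x \<in> X" "y \<in> X" "e x = e y" for x y
  proof -
    have "(m x, w) \<in> r \<longleftrightarrow> (m y, w) \<in> r" for w
    proof (cases "w \<in> m ` X")
      case True
      then show ?thesis
        using rel xy by auto
    next
      case False
      then show ?thesis
        using r by auto
    qed
    then show ?thesis
      by auto
  qed
  have "inj_on \<Phi> ((\<lambda>x. r `` {m x}) ` X)"
  proof (rule inj_onI, elim imageE, hypsubst)
    fix x y assume "\<Phi> (r `` {m x}) = \<Phi> (r `` {m y})" and xy: "x \<in> X" "y \<in> X"
    then have "e x = e y"
      by (simp only: \<Phi>)
    then show "r `` {m x} = r `` {m y}"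
      by (rule class_eq[OF xy])
  qed
  moreover have "\<Phi> ` (\<lambda>x. r `` {m x}) ` X = e ` X"
    unfolding image_image by (rule image_cong) (simp_all add: \<Phi>)
  moreover have "(m ` X) // r = (\<lambda>x. r `` {m x}) ` X"
    unfolding quotient_def by blast
  ultimately have "bij_betw \<Phi> ((m ` X) // r) (e ` X)"
    by (simp only: bij_betw_def)
  with \<Phi> show ?thesis
    by blast
qed

theorem corollary3p2:
  fixes L :: "(real^'n) set" and G :: "(real^'n^'n) set" and J :: "real^'n^'n"
  assumes "even CARD('n)"
    and "is_lattice L"
    and "subgroup G matrix_GL" and "finite G"
    and "\<forall>g\<in>G. orthogonal_matrix g"
    and "\<forall>g\<in>G. (*v) g ` L = L"
    and "invertible J" and "J ** J = - mat 1"
    and "\<forall>g\<in>G. J ** g = g ** J"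
  defines "\<M> \<equiv> flat_kaehler_manifolds L G"
    and "N\<^sub>J \<equiv> complex_normalizer L G J"
  shows "\<exists>\<Phi>. bij_betw \<Phi> (\<M> // biholomorphism_rel J \<M>)
                (orbits N\<^sub>J (special_classes G L) (class_action G)) \<and>
             (\<forall>\<Gamma>\<in>bieberbach_groups L G.
                \<Phi> (biholomorphism_rel J \<M> `` {flat_manifold \<Gamma>}) =
                orbit N\<^sub>J (class_action G) (extension_class G L \<Gamma>))"
proof -
  interpret holonomy_representation L G
    by (rule holonomy_representation.intro) (fact assms)+
  let ?orb = "\<lambda>\<Gamma>. orbit N\<^sub>J (class_action G) (extension_class G L \<Gamma>)"
  have "(flat_manifold \<Gamma>\<^sub>1, flat_manifold \<Gamma>\<^sub>2) \<in> biholomorphism_rel J \<M> \<longleftrightarrow> ?orb \<Gamma>\<^sub>1 = ?orb \<Gamma>\<^sub>2"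
    if "\<Gamma>\<^sub>1 \<in> bieberbach_groups L G" "\<Gamma>\<^sub>2 \<in> bieberbach_groups L G" for \<Gamma>\<^sub>1 \<Gamma>\<^sub>2
    using that biholomorphic_iff_class_action[OF that assms(8,9)]
    by (simp add: biholomorphism_rel_def \<M>_def flat_kaehler_manifolds_def N\<^sub>J_def
        class_orbit_eq_iff[OF extension_class_subset_cocycles extension_class_subset_cocycles])
  moreover have "biholomorphism_rel J \<M> \<subseteq> flat_manifold ` bieberbach_groups L G \<times> flat_manifold ` bieberbach_groups L G"
    by (auto simp: biholomorphism_rel_def \<M>_def flat_kaehler_manifolds_def)
  ultimately have "\<exists>\<Phi>. bij_betw \<Phi> ((flat_manifold ` bieberbach_groups L G) // biholomorphism_rel J \<M>)
      (?orb ` bieberbach_groups L G) \<and>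
      (\<forall>\<Gamma>\<in>bieberbach_groups L G. \<Phi> (biholomorphism_rel J \<M> `` {flat_manifold \<Gamma>}) = ?orb \<Gamma>)"
    by (rule quotient_bij_betw_invariant)
  moreover have "special_classes G L = extension_class G L ` bieberbach_groups L G"
  proof (intro equalityI subsetI)
    fix c assume "c \<in> special_classes G L"
    then show "c \<in> extension_class G L ` bieberbach_groups L G"
      by (rule special_class_realized) (rule image_eqI, rule sym)
  qed (use extension_class_special in blast)
  then have "orbits N\<^sub>J (special_classes G L) (class_action G) = ?orb ` bieberbach_groups L G"
    by (simp only: orbits_def Setcompr_eq_image image_image)
  ultimately show ?thesis
    by (simp only: \<M>_def flat_kaehler_manifolds_def)
qed

end
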